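(* Consider the scalar equation $\dot{x}(t)+\sum_{k=1}^m a_k(t)x(h_k(t))=0$ (coefficients of arbitrary sign). Suppose there exists a set of indices $I\subset\{1,\dots,m\}$ such that $a_k(t)\ge0$ for $k\in I$, $$\int_0^\infty\sum_{k\in I}a_k(t)\,dt=\infty,\qquad \limsup_{t\to\infty}\int_{h_k(t)}^t\sum_{i\in I}a_i(s)\,ds<\infty,\quad k=1,\dots,m,$$ and, with $E=\left\{t\ge0:\ \sum_{k\in I}a_k(t)=0\right\}$, $$\sum_{k\notin I}|a_k(t)|=0\ \text{ for } t\in E,\qquad \limsup_{t\to\infty,\ t\notin E}\frac{\sum_{k\notin I}|a_k(t)|}{\sum_{k\in I}a_k(t)}<1.$$ If the fundamental function $X_0(t,s)$ of the equation $\dot{x}(t)+\sum_{k\in I}a_k(t)x(h_k(t))=0$ is eventually positive, then all solutions of $\dot{x}(t)+\sum_{k=1}^m a_k(t)x(h_k(t))=0$ tend to zero as $t\to\infty$. If in addition there exists $R>0$ such that $\liminf_{t\to\infty}\int_t^{t+R}\sum_{k\in I}a_k(\tau)\,d\tau>0$, then the fundamental function of $\dot{x}(t)+\sum_{k=1}^m a_k(t)x(h_k(t))=0$ has an exponential estimation. If moreover also $\limsup_{t\to\infty}(t-h_k(t))<\infty$ for $k=1,\dots,m$, then $\dot{x}(t)+\sum_{k=1}^m a_k(t)x(h_k(t))=0$ is exponentially stable.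
   Context: Standing assumptions: $a_k:[0,\infty)\to\mathbb{R}$ are Lebesgue measurable and essentially bounded; $h_k:[0,\infty)\to\mathbb{R}$ are Lebesgue measurable, $h_k(t)\le t$, $\lim_{t\to\infty}h_k(t)=\infty$ (so $h_k(t)\ge 0$ for large $t$ and the integrals in the limit conditions make sense). For any $t_0\ge 0$, $x_0\in\mathbb{R}$ and any bounded Borel measurable $\varphi:(-\infty,t_0)\to\mathbb{R}$, the solution of an equation of this form with initial conditions $x(t)=\varphi(t)$ for $t<t_0$, $x(t_0)=x_0$ is the function satisfying these conditions which is locally absolutely continuous on $[t_0,\infty)$ and satisfies the equation for almost all $t\ge t_0$. "All solutions" means all $t_0\ge 0$ and all such initial data. The fundamental function $X(t,s)$ of such an equation is, for each $s\ge0$, the solution on $t\ge s$ with $X(t,s)=0$ for $t<s$ and $X(s,s)=1$. It has an exponential estimation if there are $K>0,\lambda>0$ with $|X(t,s)|\le Ke^{-\lambda(t-s)}$ for all $t\ge s\ge 0$. It is eventually positive if there is $t_1\ge0$ with $X(t,s)>0$ for all $t\ge s\ge t_1$. The equation is exponentially stable if there are $M>0,\mu>0$, independent of $t_0$ and of the initial data, such that every solution satisfies $|x(t)|\le Me^{-\mu(t-t_0)}\left(|x(t_0)|+\sup_{t<t_0}|\varphi(t)|\right)$ for $t\ge t_0$. *)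

theory Defs
  imports "HOL-Analysis.Analysis"
begin

definition abs_continuous_interval :: "(real \<Rightarrow> real) \<Rightarrow> real \<Rightarrow> real \<Rightarrow> bool" where
  "abs_continuous_interval f a b \<longleftrightarrow>
     (\<forall>\<epsilon>>0. \<exists>\<delta>>0. \<forall>(n::nat) (u :: nat \<Rightarrow> real) (v :: nat \<Rightarrow> real).
        (\<forall>i<n. a \<le> u i \<and> u i \<le> v i \<and> v i \<le> b) \<longrightarrow>
        disjoint_family_on (\<lambda>i. {u i<..<v i}) {..<n} \<longrightarrow>
        (\<Sum>i<n. v i - u i) < \<delta> \<longrightarrow>
        (\<Sum>i<n. \<bar>f (v i) - f (u i)\<bar>) < \<epsilon>)"

definition locally_abs_continuous_from :: "real \<Rightarrow> (real \<Rightarrow> real) \<Rightarrow> bool" where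
  "locally_abs_continuous_from t0 f \<longleftrightarrow> (\<forall>b\<ge>t0. abs_continuous_interval f t0 b)"

definition ess_bounded_nonneg :: "(real \<Rightarrow> real) \<Rightarrow> bool" where
  "ess_bounded_nonneg f \<longleftrightarrow> (\<exists>C. AE t in lebesgue_on {0..}. \<bar>f t\<bar> \<le> C)"

(* An initial function is a total function of which only the values on {..<t0} matter. *)
definition initial_function :: "real \<Rightarrow> (real \<Rightarrow> real) \<Rightarrow> bool" where
  "initial_function t0 \<phi> \<longleftrightarrow>
     \<phi> \<in> borel_measurable (restrict_space borel {..<t0}) \<and> bounded (\<phi> ` {..<t0})"

(* Solutions of x'(t) + (\<Sum>k\<in>J. a k t * x (h k t)) = 0 for almost all t \<ge> t0.
   Only the values of a k and h k on {0..} matter, as t0 \<ge> 0 wherever this is used. *)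
definition delay_solution ::
  "nat set \<Rightarrow> (nat \<Rightarrow> real \<Rightarrow> real) \<Rightarrow> (nat \<Rightarrow> real \<Rightarrow> real) \<Rightarrow>
   real \<Rightarrow> (real \<Rightarrow> real) \<Rightarrow> real \<Rightarrow> (real \<Rightarrow> real) \<Rightarrow> bool" where
  "delay_solution J a h t0 \<phi> x0 x \<longleftrightarrow>
     (\<forall>t<t0. x t = \<phi> t) \<and> x t0 = x0 \<and>
     locally_abs_continuous_from t0 x \<and>
     (AE t in lebesgue_on {t0..}.
        (x has_real_derivative - (\<Sum>k\<in>J. a k t * x (h k t))) (at t))"

(* For finite J, measurable essentially bounded a k, measurable h k with h k t \<le> t, and s \<ge> 0, the
   solution exists and is unique, also as a total function since its values left of s are prescribed. *)
definition fundamental_function ::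
  "nat set \<Rightarrow> (nat \<Rightarrow> real \<Rightarrow> real) \<Rightarrow> (nat \<Rightarrow> real \<Rightarrow> real) \<Rightarrow> real \<Rightarrow> real \<Rightarrow> real" where
  "fundamental_function J a h t s = (THE x. delay_solution J a h s (\<lambda>_. 0) 1 x) t"

definition eventually_positive :: "(real \<Rightarrow> real \<Rightarrow> real) \<Rightarrow> bool" where
  "eventually_positive X \<longleftrightarrow> (\<exists>t1\<ge>0. \<forall>s\<ge>t1. \<forall>t\<ge>s. X t s > 0)"

definition has_exponential_estimation :: "(real \<Rightarrow> real \<Rightarrow> real) \<Rightarrow> bool" where
  "has_exponential_estimation X \<longleftrightarrow>
     (\<exists>K>0. \<exists>\<gamma>>0. \<forall>s\<ge>0. \<forall>t\<ge>s. \<bar>X t s\<bar> \<le> K * exp (- \<gamma> * (t - s)))"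

definition all_solutions_tend_to_zero ::
  "nat set \<Rightarrow> (nat \<Rightarrow> real \<Rightarrow> real) \<Rightarrow> (nat \<Rightarrow> real \<Rightarrow> real) \<Rightarrow> bool" where
  "all_solutions_tend_to_zero J a h \<longleftrightarrow>
     (\<forall>t0\<ge>0. \<forall>\<phi> x0 x. initial_function t0 \<phi> \<longrightarrow> delay_solution J a h t0 \<phi> x0 x \<longrightarrow>
        (x \<longlongrightarrow> 0) at_top)"

definition exponentially_stable ::
  "nat set \<Rightarrow> (nat \<Rightarrow> real \<Rightarrow> real) \<Rightarrow> (nat \<Rightarrow> real \<Rightarrow> real) \<Rightarrow> bool" where
  "exponentially_stable J a h \<longleftrightarrow>
     (\<exists>M>0. \<exists>\<mu>>0. \<forall>t0\<ge>0. \<forall>\<phi> x0 x.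
        initial_function t0 \<phi> \<longrightarrow> delay_solution J a h t0 \<phi> x0 x \<longrightarrow>
        (\<forall>t\<ge>t0. \<bar>x t\<bar> \<le> M * exp (- \<mu> * (t - t0)) * (\<bar>x t0\<bar> + (SUP s\<in>{..<t0}. \<bar>\<phi> s\<bar>))))"

end

theory Submission
  imports Defs
begin

text \<open>Let \<open>b\<close> be the sum of the \<open>a k\<close> with \<open>k \<in> I\<close> and let \<open>B\<close> be its primitive; in the time scale \<open>B\<close>
  the delays are eventually bounded by some \<open>L\<close>. A single positive solution \<open>X\<close> of the equation
  with index set \<open>I\<close> yields a comparison principle: a function that vanishes before \<open>T\<close>, is nonnegative
  at \<open>T\<close> and satisfies \<open>y' t + (\<Sum>k\<in>I. a k t * y (h k t)) \<ge> 0\<close> afterwards is nonnegative.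
  Constants are supersolutions with margin \<open>b\<close>, so a function whose defect
  in the equation with index set \<open>I\<close> is at most \<open>Q b\<close> times its running supremum, \<open>Q < 1\<close>, is bounded by
  a multiple of its history. For a solution \<open>x\<close> of the full equation and small \<open>\<nu> > 0\<close>, this applies to
  \<open>exp (\<nu> (B t - B T)) * x t\<close>; hence \<open>x\<close> decays exponentially in the time scale \<open>B\<close>, uniformly in
  the initial time and data.\<close>

subsection \<open>Absolutely continuous functions\<close>

text \<open>Differential inequalities hold only almost everywhere, so every comparison is reduced to
  one fact: an absolutely continuous function with almost everywhere nonpositive derivative does not
  increase.

  Positivity of \<open>fundamental_function I a h\<close> concerns a definite description, which
  carries information only once existence and uniqueness are proved; existence needs the almost
  everywhere differentiability of integrals. Of the fundamental function only the column started at
  \<open>t1\<close> is used: it is the denominator of \<open>y / X\<close>, whose maximum point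
  yields the comparison principle without a representation formula.

  The obstacle is the history before \<open>T\<close>: it is nonzero and of either sign, while
  comparison wants functions vanishing there. Cutting it off costs an error of size
  \<open>S * b t\<close>, but only until \<open>B\<close> has grown by more than \<open>L\<close>,
  since later no delayed argument lies before \<open>T\<close>. A term growing over that window and
  constant afterwards pays for it, and this keeps the constants independent of \<open>T\<close> and
  of the data. The weight in the last step changes over one delay by a factor of at most
  \<open>exp (\<nu> * L)\<close>, close to 1 for small \<open>\<nu>\<close>, so the margin
  \<open>Q < 1\<close> survives.\<close>

lemma ac_subinterval:
  assumes "abs_continuous_interval f a b" "a \<le> c" "d \<le> b"
  shows "abs_continuous_interval f c d"
  unfolding abs_continuous_interval_def
proof (intro allI impI)
  fix \<epsilon> :: real assume "\<epsilon> > 0"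
  then obtain \<delta> where "\<delta> > 0" and \<delta>: "\<And>(n::nat) u v. (\<forall>i<n. a \<le> u i \<and> u i \<le> v i \<and> v i \<le> b) \<Longrightarrow>
        disjoint_family_on (\<lambda>i. {u i<..<v i}) {..<n} \<Longrightarrow> (\<Sum>i<n. v i - u i) < \<delta> \<Longrightarrow>
        (\<Sum>i<n. \<bar>f (v i) - f (u i)\<bar>) < \<epsilon>"
    using assms(1) unfolding abs_continuous_interval_def by meson
  show "\<exists>\<delta>>0. \<forall>(n::nat) u v. (\<forall>i<n. c \<le> u i \<and> u i \<le> v i \<and> v i \<le> d) \<longrightarrow>
        disjoint_family_on (\<lambda>i. {u i<..<v i}) {..<n} \<longrightarrow> (\<Sum>i<n. v i - u i) < \<delta> \<longrightarrow>
        (\<Sum>i<n. \<bar>f (v i) - f (u i)\<bar>) < \<epsilon>"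
  proof (intro exI[of _ \<delta>] conjI allI impI)
    fix n :: nat and u v
    assume "\<forall>i<n. c \<le> u i \<and> u i \<le> v i \<and> v i \<le> d"
      and *: "disjoint_family_on (\<lambda>i. {u i<..<v i}) {..<n}" "(\<Sum>i<n. v i - u i) < \<delta>"
    then have "\<forall>i<n. a \<le> u i \<and> u i \<le> v i \<and> v i \<le> b"
      using assms(2,3) by fastforce
    then show "(\<Sum>i<n. \<bar>f (v i) - f (u i)\<bar>) < \<epsilon>"
      using * by (rule \<delta>)
  qed (rule \<open>\<delta> > 0\<close>)
qed

text \<open>The definition indexes intervals by initial segments of the naturals, whereas the cells
  of a tagged division form a bare finite set; a bijection with \<open>{..<card P}\<close> transfers
  the estimate.\<close>

lemma ac_finite_family:
  assumes "abs_continuous_interval f a b" "\<epsilon> > 0"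
  obtains \<delta> where "\<delta> > 0"
    "\<And>(P :: 'i set) u v. finite P \<Longrightarrow> (\<And>i. i \<in> P \<Longrightarrow> a \<le> u i \<and> u i \<le> v i \<and> v i \<le> b) \<Longrightarrow>
       disjoint_family_on (\<lambda>i. {u i<..<v i}) P \<Longrightarrow> (\<Sum>i\<in>P. v i - u i) < \<delta> \<Longrightarrow>
       (\<Sum>i\<in>P. \<bar>f (v i) - f (u i)\<bar>) < \<epsilon>"
proof -
  obtain \<delta> where "\<delta> > 0" and \<delta>: "\<And>(n::nat) u v. (\<forall>i<n. a \<le> u i \<and> u i \<le> v i \<and> v i \<le> b) \<Longrightarrow>
        disjoint_family_on (\<lambda>i. {u i<..<v i}) {..<n} \<Longrightarrow> (\<Sum>i<n. v i - u i) < \<delta> \<Longrightarrow>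
        (\<Sum>i<n. \<bar>f (v i) - f (u i)\<bar>) < \<epsilon>"
    using assms unfolding abs_continuous_interval_def by meson
  show ?thesis
  proof (rule that[OF \<open>\<delta> > 0\<close>])
    fix P :: "'i set" and u v
    assume P: "finite P" "\<And>i. i \<in> P \<Longrightarrow> a \<le> u i \<and> u i \<le> v i \<and> v i \<le> b"
      "disjoint_family_on (\<lambda>i. {u i<..<v i}) P" "(\<Sum>i\<in>P. v i - u i) < \<delta>"
    obtain h where h: "bij_betw h {..<card P} P"
      using ex_bij_betw_nat_finite[OF P(1)] by (auto simp: atLeast0LessThan)
    have "(\<Sum>i<card P. \<bar>f (v (h i)) - f (u (h i))\<bar>) < \<epsilon>"
    proof (rule \<delta>[where u="\<lambda>i. u (h i)" and v="\<lambda>i. v (h i)"])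
      show "\<forall>i<card P. a \<le> u (h i) \<and> u (h i) \<le> v (h i) \<and> v (h i) \<le> b"
        using h P(2) by (auto simp: bij_betw_def)
      show "disjoint_family_on (\<lambda>i. {u (h i)<..<v (h i)}) {..<card P}"
        unfolding disjoint_family_on_def
      proof (intro ballI impI)
        fix i j assume "i \<in> {..<card P}" "j \<in> {..<card P}" "i \<noteq> j"
        then have "h i \<in> P" "h j \<in> P" "h i \<noteq> h j"
          using h by (auto simp: bij_betw_def inj_on_def)
        with P(3) show "{u (h i)<..<v (h i)} \<inter> {u (h j)<..<v (h j)} = {}"
          by (auto simp: disjoint_family_on_def)
      qed
      show "(\<Sum>i<card P. v (h i) - u (h i)) < \<delta>"
        using P(4) sum.reindex_bij_betw[OF h, of "\<lambda>i. v i - u i"] by simp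
    qed
    then show "(\<Sum>i\<in>P. \<bar>f (v i) - f (u i)\<bar>) < \<epsilon>"
      using sum.reindex_bij_betw[OF h, of "\<lambda>i. \<bar>f (v i) - f (u i)\<bar>"] by simp
  qed
qed

text \<open>Increment bounds can be summed over any family of intervals. Sums, products,
  \<open>exp\<close> and later the stopped function \<open>B (min t V)\<close> are all treated
  through such bounds.\<close>

lemma ac_dominated:
  assumes f: "abs_continuous_interval f a b" and g: "abs_continuous_interval g a b" and "M \<ge> 0"
    and le: "\<And>s t. a \<le> s \<Longrightarrow> s \<le> t \<Longrightarrow> t \<le> b \<Longrightarrow>
      \<bar>F t - F s\<bar> \<le> M * \<bar>f t - f s\<bar> + M * \<bar>g t - g s\<bar>"
  shows "abs_continuous_interval F a b"
  unfolding abs_continuous_interval_def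
proof (intro allI impI)
  fix \<epsilon> :: real assume "\<epsilon> > 0"
  \<comment> \<open>This gives \<open>2 * M * \<eta> < \<epsilon>\<close>; the added 1 covers
    \<open>M = 0\<close>.\<close>
  define \<eta> where "\<eta> = \<epsilon> / (2 * (M + 1))"
  have "\<eta> > 0" using \<open>\<epsilon> > 0\<close> \<open>M \<ge> 0\<close> by (simp add: \<eta>_def)
  obtain \<delta>1 where "\<delta>1 > 0" and \<delta>1: "\<And>(n::nat) u v. (\<forall>i<n. a \<le> u i \<and> u i \<le> v i \<and> v i \<le> b) \<Longrightarrow>
        disjoint_family_on (\<lambda>i. {u i<..<v i}) {..<n} \<Longrightarrow> (\<Sum>i<n. v i - u i) < \<delta>1 \<Longrightarrow>
        (\<Sum>i<n. \<bar>f (v i) - f (u i)\<bar>) < \<eta>"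
    using f \<open>\<eta> > 0\<close> unfolding abs_continuous_interval_def by meson
  obtain \<delta>2 where "\<delta>2 > 0" and \<delta>2: "\<And>(n::nat) u v. (\<forall>i<n. a \<le> u i \<and> u i \<le> v i \<and> v i \<le> b) \<Longrightarrow>
        disjoint_family_on (\<lambda>i. {u i<..<v i}) {..<n} \<Longrightarrow> (\<Sum>i<n. v i - u i) < \<delta>2 \<Longrightarrow>
        (\<Sum>i<n. \<bar>g (v i) - g (u i)\<bar>) < \<eta>"
    using g \<open>\<eta> > 0\<close> unfolding abs_continuous_interval_def by meson
  show "\<exists>\<delta>>0. \<forall>(n::nat) u v. (\<forall>i<n. a \<le> u i \<and> u i \<le> v i \<and> v i \<le> b) \<longrightarrow>
        disjoint_family_on (\<lambda>i. {u i<..<v i}) {..<n} \<longrightarrow> (\<Sum>i<n. v i - u i) < \<delta> \<longrightarrow>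
        (\<Sum>i<n. \<bar>F (v i) - F (u i)\<bar>) < \<epsilon>"
  proof (intro exI[of _ "min \<delta>1 \<delta>2"] conjI allI impI)
    show "min \<delta>1 \<delta>2 > 0" using \<open>\<delta>1 > 0\<close> \<open>\<delta>2 > 0\<close> by simp
    fix n :: nat and u v
    assume A: "\<forall>i<n. a \<le> u i \<and> u i \<le> v i \<and> v i \<le> b"
      "disjoint_family_on (\<lambda>i. {u i<..<v i}) {..<n}" "(\<Sum>i<n. v i - u i) < min \<delta>1 \<delta>2"
    have "(\<Sum>i<n. \<bar>F (v i) - F (u i)\<bar>)
        \<le> (\<Sum>i<n. M * \<bar>f (v i) - f (u i)\<bar> + M * \<bar>g (v i) - g (u i)\<bar>)"
      using A(1) by (intro sum_mono le) auto
    also have "\<dots> = M * (\<Sum>i<n. \<bar>f (v i) - f (u i)\<bar>) + M * (\<Sum>i<n. \<bar>g (v i) - g (u i)\<bar>)"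
      by (simp add: sum.distrib sum_distrib_left)
    also have "\<dots> \<le> M * \<eta> + M * \<eta>"
      using \<delta>1[of n u v] \<delta>2[of n u v] A \<open>M \<ge> 0\<close> by (intro add_mono mult_left_mono) auto
    also have "\<dots> < 2 * (M + 1) * \<eta>"
      using \<open>\<eta> > 0\<close> by (simp add: algebra_simps)
    also have "\<dots> = \<epsilon>"
      using \<open>M \<ge> 0\<close> by (simp add: \<eta>_def)
    finally show "(\<Sum>i<n. \<bar>F (v i) - F (u i)\<bar>) < \<epsilon>" .
  qed
qed

lemma ac_cong:
  assumes "abs_continuous_interval f a b" "\<And>t. a \<le> t \<Longrightarrow> t \<le> b \<Longrightarrow> f t = g t"
  shows "abs_continuous_interval g a b"
  by (rule ac_dominated[OF assms(1) assms(1), where M=1]) (use assms(2) in auto)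

lemma ac_ident: "abs_continuous_interval (\<lambda>t. t) a b"
  unfolding abs_continuous_interval_def
proof (intro allI impI)
  fix \<epsilon> :: real assume "\<epsilon> > 0"
  have "(\<Sum>i<n. \<bar>v i - u i\<bar>) < \<epsilon>"
    if "\<forall>i<n. a \<le> u i \<and> u i \<le> v i \<and> v i \<le> b" "(\<Sum>i<n. v i - u i) < \<epsilon>" for n :: nat and u v
  proof -
    have "(\<Sum>i<n. \<bar>v i - u i\<bar>) = (\<Sum>i<n. v i - u i)"
      using that(1) by (intro sum.cong) auto
    with that(2) show ?thesis by simp
  qed
  then show "\<exists>\<delta>>0. \<forall>(n::nat) u v. (\<forall>i<n. a \<le> u i \<and> u i \<le> v i \<and> v i \<le> b) \<longrightarrow>
        disjoint_family_on (\<lambda>i. {u i<..<v i}) {..<n} \<longrightarrow> (\<Sum>i<n. v i - u i) < \<delta> \<longrightarrow>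
        (\<Sum>i<n. \<bar>v i - u i\<bar>) < \<epsilon>"
    using \<open>\<epsilon> > 0\<close> by blast
qed

lemma ac_lipschitz:
  assumes "\<And>s t. a \<le> s \<Longrightarrow> s \<le> t \<Longrightarrow> t \<le> b \<Longrightarrow> \<bar>F t - F s\<bar> \<le> C * (t - s)"
  shows "abs_continuous_interval F a b"
proof (rule ac_dominated[OF ac_ident ac_ident])
  fix s t :: real assume "a \<le> s" "s \<le> t" "t \<le> b"
  then have "\<bar>F t - F s\<bar> \<le> C * (t - s)" by (rule assms)
  also have "\<dots> \<le> \<bar>C\<bar> * (t - s)" using \<open>s \<le> t\<close> by (intro mult_right_mono) auto
  finally show "\<bar>F t - F s\<bar> \<le> \<bar>C\<bar> * \<bar>t - s\<bar> + \<bar>C\<bar> * \<bar>t - s\<bar>"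
    using \<open>s \<le> t\<close> mult_nonneg_nonneg[of "\<bar>C\<bar>" "t - s"] by simp
qed simp

lemma ac_const: "abs_continuous_interval (\<lambda>t. c) a b"
  by (rule ac_lipschitz[where C=0]) simp

lemma ac_add:
  assumes "abs_continuous_interval f a b" "abs_continuous_interval g a b"
  shows "abs_continuous_interval (\<lambda>t. f t + g t) a b"
  by (rule ac_dominated[OF assms, where M=1]) auto

lemma ac_cmult:
  assumes "abs_continuous_interval f a b"
  shows "abs_continuous_interval (\<lambda>t. c * f t) a b"
proof (rule ac_dominated[OF assms assms, where M="\<bar>c\<bar>"])
  fix s t
  show "\<bar>c * f t - c * f s\<bar> \<le> \<bar>c\<bar> * \<bar>f t - f s\<bar> + \<bar>c\<bar> * \<bar>f t - f s\<bar>"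
    by (simp add: right_diff_distrib[symmetric] abs_mult)
qed simp

lemma ac_diff:
  assumes "abs_continuous_interval f a b" "abs_continuous_interval g a b"
  shows "abs_continuous_interval (\<lambda>t. f t - g t) a b"
  by (rule ac_dominated[OF assms, where M=1]) auto

lemma ac_uminus:
  assumes "abs_continuous_interval f a b"
  shows "abs_continuous_interval (\<lambda>t. - f t) a b"
  using ac_cmult[OF assms, of "-1"] by simp

lemma ac_continuous_on:
  assumes "abs_continuous_interval f a b"
  shows "continuous_on {a..b} f"
  unfolding continuous_on_iff
proof (intro ballI allI impI)
  fix x \<epsilon> :: real assume x: "x \<in> {a..b}" and "\<epsilon> > 0"
  then obtain \<delta> where "\<delta> > 0" and \<delta>: "\<And>(n::nat) u v. (\<forall>i<n. a \<le> u i \<and> u i \<le> v i \<and> v i \<le> b) \<Longrightarrow>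
        disjoint_family_on (\<lambda>i. {u i<..<v i}) {..<n} \<Longrightarrow> (\<Sum>i<n. v i - u i) < \<delta> \<Longrightarrow>
        (\<Sum>i<n. \<bar>f (v i) - f (u i)\<bar>) < \<epsilon>"
    using assms unfolding abs_continuous_interval_def by meson
  have "dist (f y) (f x) < \<epsilon>" if "y \<in> {a..b}" "dist y x < \<delta>" for y
    using \<delta>[of 1 "\<lambda>_. min x y" "\<lambda>_. max x y"] that x
    by (cases "x \<le> y") (auto simp: dist_real_def disjoint_family_on_def min_def max_def)
  with \<open>\<delta> > 0\<close> show "\<exists>d>0. \<forall>x'\<in>{a..b}. dist x' x < d \<longrightarrow> dist (f x') (f x) < \<epsilon>"
    by blast
qed

lemma ac_bounded:
  assumes "abs_continuous_interval f a b"
  obtains M where "M \<ge> 0" "\<And>t. a \<le> t \<Longrightarrow> t \<le> b \<Longrightarrow> \<bar>f t\<bar> \<le> M"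
proof -
  have "bounded (f ` {a..b})"
    using ac_continuous_on[OF assms] compact_continuous_image compact_imp_bounded by blast
  then obtain M where "M > 0" "\<And>y. y \<in> f ` {a..b} \<Longrightarrow> norm y \<le> M"
    by (auto simp: bounded_pos)
  then show ?thesis by (intro that[of M]) auto
qed

lemma ac_mult:
  assumes f: "abs_continuous_interval f a b" and g: "abs_continuous_interval g a b"
  shows "abs_continuous_interval (\<lambda>t. f t * g t) a b"
proof -
  obtain M where M: "M \<ge> 0" "\<And>t. a \<le> t \<Longrightarrow> t \<le> b \<Longrightarrow> \<bar>f t\<bar> \<le> M"
    using ac_bounded[OF f] by blast
  obtain N where N: "N \<ge> 0" "\<And>t. a \<le> t \<Longrightarrow> t \<le> b \<Longrightarrow> \<bar>g t\<bar> \<le> N"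
    using ac_bounded[OF g] by blast
  show ?thesis
  proof (rule ac_dominated[OF f g, where M="M + N"])
    fix s t assume st: "a \<le> s" "s \<le> t" "t \<le> b"
    have "\<bar>f t * g t - f s * g s\<bar> = \<bar>(f t - f s) * g t + f s * (g t - g s)\<bar>"
      by (simp add: algebra_simps)
    also have "\<dots> \<le> \<bar>f t - f s\<bar> * \<bar>g t\<bar> + \<bar>f s\<bar> * \<bar>g t - g s\<bar>"
      by (metis abs_mult abs_triangle_ineq)
    also have "\<dots> \<le> \<bar>f t - f s\<bar> * (M + N) + (M + N) * \<bar>g t - g s\<bar>"
      using M(1) N(1) M(2)[of s] N(2)[of t] st by (intro add_mono mult_left_mono mult_right_mono) auto
    finally show "\<bar>f t * g t - f s * g s\<bar> \<le> (M + N) * \<bar>f t - f s\<bar> + (M + N) * \<bar>g t - g s\<bar>"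
      by (simp add: mult.commute)
  qed (use M(1) N(1) in auto)
qed

lemma ac_exp:
  assumes f: "abs_continuous_interval f a b"
  shows "abs_continuous_interval (\<lambda>t. exp (f t)) a b"
proof -
  obtain M where M: "M \<ge> 0" "\<And>t. a \<le> t \<Longrightarrow> t \<le> b \<Longrightarrow> \<bar>f t\<bar> \<le> M"
    using ac_bounded[OF f] by blast
  have exp_le: "\<bar>exp y - exp x\<bar> \<le> exp M * \<bar>y - x\<bar>" if "\<bar>x\<bar> \<le> M" "\<bar>y\<bar> \<le> M" for x y :: real
  proof -
    have "norm (exp y - exp x) \<le> exp M * norm (y - x)"
    proof (rule field_differentiable_bound[where S="{-M..M}" and f'=exp])
      show "(exp has_field_derivative exp z) (at z within {-M..M})" for z :: real
        by (rule DERIV_exp[THEN has_field_derivative_at_within])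
    qed (use that in auto)
    then show ?thesis by simp
  qed
  show ?thesis
  proof (rule ac_dominated[OF f f, where M="exp M"])
    fix s t assume "a \<le> s" "s \<le> t" "t \<le> b"
    then have "\<bar>exp (f t) - exp (f s)\<bar> \<le> exp M * \<bar>f t - f s\<bar>"
      using M(2) by (intro exp_le) auto
    then show "\<bar>exp (f t) - exp (f s)\<bar> \<le> exp M * \<bar>f t - f s\<bar> + exp M * \<bar>f t - f s\<bar>"
      using mult_nonneg_nonneg[of "exp M" "\<bar>f t - f s\<bar>"] by simp
  qed simp
qed

section \<open>Monotonicity from the sign of the derivative almost everywhere\<close>

lemma negligible_open_cover:
  fixes N :: "real set"
  assumes "negligible N" "e > 0"
  obtains U where "open U" "N \<subseteq> U" "U \<in> lmeasurable" "measure lebesgue U < e"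
proof -
  have N: "N \<in> lmeasurable" "measure lebesgue N = 0"
    using assms(1) negligible_imp_measurable negligible_imp_measure0 by blast+
  obtain U where U: "open U" "N \<subseteq> U" "U - N \<in> lmeasurable" "emeasure lebesgue (U - N) < ennreal e"
    using sets_lebesgue_outer_open[of N e] N assms(2) by blast
  have UN: "U = (U - N) \<union> N" using U(2) by blast
  have "U \<in> lmeasurable"
    using U(3) N(1) UN fmeasurable.Un by metis
  moreover have "measure lebesgue (U - N) < e"
    using U(3,4) assms(2) by (simp add: emeasure_eq_measure2 ennreal_less_iff)
  moreover have "measure lebesgue U \<le> measure lebesgue (U - N) + measure lebesgue N"
    using measure_Un_le[of "U - N" lebesgue N] U(3) N(1) UN by (simp add: fmeasurableD)
  ultimately show ?thesis
    using U(1,2) N(2) that by simp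
qed

text \<open>Tags outside the exceptional null set are controlled by the derivative, tags inside it by
  absolute continuity, since their intervals lie in an open set of small measure.\<close>

lemma ac_nonincreasing:
  assumes ac: "abs_continuous_interval f a b" and "a \<le> b"
    and ae: "AE t in lebesgue. a < t \<and> t < b \<longrightarrow> (\<exists>D\<le>0. (f has_real_derivative D) (at t))"
  shows "f b \<le> f a"
proof (rule field_le_epsilon)
  fix e :: real assume "e > 0"
  obtain N0 where N0: "{t \<in> space lebesgue. \<not> (a < t \<and> t < b \<longrightarrow> (\<exists>D\<le>0. (f has_real_derivative D) (at t)))} \<subseteq> N0"
    "N0 \<in> null_sets lebesgue"
    using ae by (auto simp: eventually_ae_filter)
  \<comment> \<open>The hypothesis speaks only of interior points, so the endpoints join the
    exceptional set.\<close>
  define N where "N = N0 \<union> {a, b}"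
  have "negligible N"
    using N0(2) by (simp add: N_def negligible_iff_null_sets[symmetric])
  obtain \<delta> where "\<delta> > 0" and \<delta>:
    "\<And>(P :: (real \<times> real set) set) u v. finite P \<Longrightarrow> (\<And>i. i \<in> P \<Longrightarrow> a \<le> u i \<and> u i \<le> v i \<and> v i \<le> b) \<Longrightarrow>
       disjoint_family_on (\<lambda>i. {u i<..<v i}) P \<Longrightarrow> (\<Sum>i\<in>P. v i - u i) < \<delta> \<Longrightarrow>
       (\<Sum>i\<in>P. \<bar>f (v i) - f (u i)\<bar>) < e / 2"
    using ac_finite_family[OF ac, of "e / 2", where 'i = "real \<times> real set"] \<open>e > 0\<close> by auto
  obtain U where U: "open U" "N \<subseteq> U" "U \<in> lmeasurable" "measure lebesgue U < \<delta>"
    using negligible_open_cover[OF \<open>negligible N\<close> \<open>\<delta> > 0\<close>] by blast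
  \<comment> \<open>One half of \<open>e\<close> is spent on tags outside \<open>N\<close>, the
    other on tags in \<open>N\<close>; the summand 1 covers \<open>a = b\<close>.\<close>
  define e1 where "e1 = e / 2 / (b - a + 1)"
  have "e1 > 0" using \<open>e > 0\<close> \<open>a \<le> b\<close> by (simp add: e1_def)
  \<comment> \<open>The gauge. Off \<open>N\<close> this is the straddle estimate: since
    \<open>u \<le> t \<le> v\<close>, the errors of the linear approximation at both ends add up to
    \<open>e1 * (v - u)\<close>, and \<open>D \<le> 0\<close> only helps.\<close>
  have "\<exists>d>0. (t \<in> N \<longrightarrow> ball t d \<subseteq> U) \<and>
      (t \<in> {a..b} - N \<longrightarrow> (\<forall>u v. u \<le> t \<and> t \<le> v \<and> {u..v} \<subseteq> ball t d \<longrightarrow> f v - f u \<le> e1 * (v - u)))" for t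
  proof (cases "t \<in> {a..b} - N")
    case True
    then have "a < t" "t < b" by (auto simp: N_def less_le)
    then obtain D where D: "D \<le> 0" "(f has_real_derivative D) (at t)"
      using True N0(1) by (auto simp: N_def)
    have "(f has_derivative (*) D) (at t)"
      using D(2) by (simp add: has_field_derivative_def)
    then obtain d where "d > 0" and d: "\<And>y. \<bar>y - t\<bar> < d \<Longrightarrow> \<bar>f y - f t - D * (y - t)\<bar> \<le> e1 * \<bar>y - t\<bar>"
      using \<open>e1 > 0\<close> unfolding has_derivative_at_alt by auto
    have "f v - f u \<le> e1 * (v - u)" if "u \<le> t" "t \<le> v" "{u..v} \<subseteq> ball t d" for u v
    proof -
      have "u \<in> {u..v}" "v \<in> {u..v}" using that(1,2) by auto
      then have "u \<in> ball t d" "v \<in> ball t d" using that(3) by blast+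
      then have "\<bar>f v - f t - D * (v - t)\<bar> \<le> e1 * (v - t)" "\<bar>f u - f t - D * (u - t)\<bar> \<le> e1 * (t - u)"
        using d[of u] d[of v] that(1,2) by (auto simp: dist_real_def abs_minus_commute)
      moreover have "D * (v - t) \<le> 0" "D * (u - t) \<ge> 0"
        using D(1) that(1,2) by (auto simp: mult_nonpos_nonneg mult_nonpos_nonpos)
      ultimately show ?thesis by (simp add: algebra_simps)
    qed
    then show ?thesis using True \<open>d > 0\<close> by blast
  next
    case False
    then show ?thesis
      using U(1,2) by (meson openE subset_iff zero_less_one)
  qed
  then obtain d where d: "\<And>t. d t > 0" "\<And>t. t \<in> N \<Longrightarrow> ball t (d t) \<subseteq> U"
    "\<And>t u v. t \<in> {a..b} - N \<Longrightarrow> u \<le> t \<Longrightarrow> t \<le> v \<Longrightarrow> {u..v} \<subseteq> ball t (d t) \<Longrightarrow> f v - f u \<le> e1 * (v - u)"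
    by metis
  obtain p where p: "p tagged_division_of {a..b}" "(\<lambda>t. ball t (d t)) fine p"
    using fine_division_exists_real[OF gauge_ball_dependent, of d] d(1) by blast
  have "finite p" using p(1) by blast
  have K: "a \<le> Inf K \<and> Inf K \<le> t \<and> t \<le> Sup K \<and> Sup K \<le> b \<and> K = {Inf K..Sup K} \<and> K \<subseteq> ball t (d t)"
    if tK: "(t, K) \<in> p" for t K
  proof -
    obtain u v where uv: "K = {u..v}"
      using tagged_division_ofD(4)[OF p(1) tK] by auto
    have "t \<in> K" "K \<subseteq> {a..b}"
      using tagged_division_ofD(2,3)[OF p(1) tK] by auto
    moreover have "K \<subseteq> ball t (d t)" using p(2) tK by (auto simp: fine_def)
    ultimately show ?thesis using uv by auto
  qed
  have len: "(\<Sum>(t,K)\<in>p. Sup K - Inf K) = b - a"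
    using additive_tagged_division_1[OF \<open>a \<le> b\<close> p(1), of "\<lambda>x. x"] .
  define P where "P = {i \<in> p. fst i \<in> N}"
  have "P \<subseteq> p" "finite P" using \<open>finite p\<close> by (auto simp: P_def)
  have "(\<Sum>i\<in>P. \<bar>f (Sup (snd i)) - f (Inf (snd i))\<bar>) < e / 2"
  proof (rule \<delta>[OF \<open>finite P\<close>])
    show "a \<le> Inf (snd i) \<and> Inf (snd i) \<le> Sup (snd i) \<and> Sup (snd i) \<le> b" if "i \<in> P" for i
      using K[of "fst i" "snd i"] that by (auto simp: P_def)
    show disj: "disjoint_family_on (\<lambda>i. {Inf (snd i)<..<Sup (snd i)}) P"
      unfolding disjoint_family_on_def
    proof (intro ballI impI)
      fix i j assume ij: "i \<in> P" "j \<in> P" "i \<noteq> j"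
      then have "interior (snd i) \<inter> interior (snd j) = {}"
        using tagged_division_ofD(5)[OF p(1), of "fst i" "snd i" "fst j" "snd j"] by (auto simp: P_def)
      moreover have "interior (snd i) = {Inf (snd i)<..<Sup (snd i)}" if "i \<in> P" for i
        using K[of "fst i" "snd i"] that interior_atLeastAtMost_real[of "Inf (snd i)" "Sup (snd i)"]
        by (auto simp: P_def)
      ultimately show "{Inf (snd i)<..<Sup (snd i)} \<inter> {Inf (snd j)<..<Sup (snd j)} = {}"
        using ij by simp
    qed
    have "(\<Sum>i\<in>P. Sup (snd i) - Inf (snd i)) = (\<Sum>i\<in>P. measure lebesgue {Inf (snd i)<..<Sup (snd i)})"
    proof (rule sum.cong)
      fix i assume "i \<in> P"
      then have "Inf (snd i) \<le> Sup (snd i)"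
        using K[of "fst i" "snd i"] by (auto simp: P_def)
      then show "Sup (snd i) - Inf (snd i) = measure lebesgue {Inf (snd i)<..<Sup (snd i)}"
        by simp
    qed simp
    also have "\<dots> = measure lebesgue (\<Union>i\<in>P. {Inf (snd i)<..<Sup (snd i)})"
    proof (rule measure_finite_Union[symmetric, OF \<open>finite P\<close> _ disj])
      show "emeasure lebesgue {Inf (snd i)<..<Sup (snd i)} \<noteq> \<infinity>" for i :: "real \<times> real set"
        using fmeasurableD2[of "{Inf (snd i)<..<Sup (snd i)}" lebesgue] bounded_set_imp_lmeasurable by auto
    qed auto
    also have "\<dots> \<le> measure lebesgue U"
    proof (rule measure_mono_fmeasurable)
      show "(\<Union>i\<in>P. {Inf (snd i)<..<Sup (snd i)}) \<subseteq> U"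
      proof (rule UN_least)
        fix i assume "i \<in> P"
        then have "snd i \<subseteq> U" "snd i = {Inf (snd i)..Sup (snd i)}"
          using K[of "fst i" "snd i"] d(2)[of "fst i"] by (auto simp: P_def)
        then show "{Inf (snd i)<..<Sup (snd i)} \<subseteq> U"
          using greaterThanLessThan_subseteq_atLeastAtMost_iff by fastforce
      qed
    qed (use U \<open>finite P\<close> in \<open>auto intro!: sets.finite_UN\<close>)
    finally show "(\<Sum>i\<in>P. Sup (snd i) - Inf (snd i)) < \<delta>" using U(4) by simp
  qed
  then have 1: "(\<Sum>i\<in>P. f (Sup (snd i)) - f (Inf (snd i))) \<le> e / 2"
    by (rule order_trans[OF order_trans[OF abs_ge_self sum_abs] less_imp_le])
  have "(\<Sum>i\<in>p-P. f (Sup (snd i)) - f (Inf (snd i))) \<le> (\<Sum>i\<in>p-P. e1 * (Sup (snd i) - Inf (snd i)))"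
  proof (rule sum_mono)
    fix i assume i: "i \<in> p - P"
    then have k: "a \<le> Inf (snd i) \<and> Inf (snd i) \<le> fst i \<and> fst i \<le> Sup (snd i) \<and> Sup (snd i) \<le> b \<and>
        snd i = {Inf (snd i)..Sup (snd i)} \<and> snd i \<subseteq> ball (fst i) (d (fst i))"
      by (intro K) simp
    moreover have "fst i \<notin> N" using i by (auto simp: P_def)
    ultimately show "f (Sup (snd i)) - f (Inf (snd i)) \<le> e1 * (Sup (snd i) - Inf (snd i))"
      by (intro d(3)[of "fst i"]) auto
  qed
  also have "\<dots> \<le> (\<Sum>i\<in>p. e1 * (Sup (snd i) - Inf (snd i)))"
  proof (rule sum_mono2[OF \<open>finite p\<close>])
    show "0 \<le> e1 * (Sup (snd i) - Inf (snd i))" if "i \<in> p - (p - P)" for i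
      using K[of "fst i" "snd i"] that \<open>e1 > 0\<close> by auto
  qed auto
  also have "\<dots> = e1 * (b - a)"
    using len by (simp add: sum_distrib_left[symmetric] case_prod_beta)
  also have "\<dots> \<le> e1 * (b - a + 1)" using \<open>e1 > 0\<close> by (simp add: algebra_simps)
  also have "\<dots> = e / 2" using \<open>a \<le> b\<close> by (simp add: e1_def del: divide_divide_eq_left)
  finally have 2: "(\<Sum>i\<in>p-P. f (Sup (snd i)) - f (Inf (snd i))) \<le> e / 2" .
  have "f b - f a = (\<Sum>i\<in>p. f (Sup (snd i)) - f (Inf (snd i)))"
    using additive_tagged_division_1[OF \<open>a \<le> b\<close> p(1), of f] by (simp add: case_prod_beta)
  also have "\<dots> = (\<Sum>i\<in>p-P. f (Sup (snd i)) - f (Inf (snd i))) + (\<Sum>i\<in>P. f (Sup (snd i)) - f (Inf (snd i)))"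
    by (rule sum.subset_diff[OF \<open>P \<subseteq> p\<close> \<open>finite p\<close>])
  finally show "f b \<le> f a + e" using 1 2 by simp
qed

subsection \<open>Lebesgue differentiation of bounded functions\<close>

lemma bounded_measurable_integrable_on:
  fixes f :: "real \<Rightarrow> real"
  assumes "f \<in> borel_measurable lebesgue" "\<And>t. \<bar>f t\<bar> \<le> C"
  shows "f integrable_on {u..v}"
proof -
  have "(\<lambda>_::real. C) integrable_on {u..v}" by (rule integrable_const_ivl)
  then have "f absolutely_integrable_on {u..v}"
    using assms
    by (intro measurable_bounded_by_integrable_imp_absolutely_integrable[where g="\<lambda>_. C"])
      (auto intro: measurable_restrict_space1)
  then show ?thesis
    by (rule set_lebesgue_integral_eq_integral(1))
qed

lemma bounded_measurable_integral_lipschitz: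
  fixes f :: "real \<Rightarrow> real"
  assumes f: "f \<in> borel_measurable lebesgue" "\<And>t. \<bar>f t\<bar> \<le> C" and st: "c \<le> s" "s \<le> t"
  shows "integral {c..t} f - integral {c..s} f = integral {s..t} f"
    and "\<bar>integral {s..t} f\<bar> \<le> C * (t - s)"
proof -
  have i: "f integrable_on {u..v}" for u v by (rule bounded_measurable_integrable_on[OF f])
  show "integral {c..t} f - integral {c..s} f = integral {s..t} f"
    using Henstock_Kurzweil_Integration.integral_combine[OF st i] by simp
  have "norm (integral {s..t} f) \<le> integral {s..t} (\<lambda>_. C)"
    using f(2) i by (intro integral_norm_bound_integral) auto
  then show "\<bar>integral {s..t} f\<bar> \<le> C * (t - s)" using st(2) by (simp add: mult.commute)
qed

text \<open>If the averages of \<open>f\<close> over arbitrarily short intervals around each point of a set exceed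
  \<open>r'\<close> while \<open>f \<le> r < r'\<close> on this set, then Vitali's theorem packs almost all of the set into
  disjoint such intervals, whose total length is bounded by the measure of the small part of a
  neighbourhood of \<open>{f \<le> r}\<close> on which \<open>f > r\<close>.\<close>

lemma negligible_large_averages:
  fixes f :: "real \<Rightarrow> real"
  assumes f: "f \<in> borel_measurable lebesgue" "\<And>t. \<bar>f t\<bar> \<le> C" and "r < r'"
  shows "negligible {x. f x \<le> r \<and> (\<forall>d>0. \<exists>u v. u \<le> x \<and> x \<le> v \<and> u < v \<and> v - u < d \<and>
    integral {u..v} f > r' * (v - u))}" (is "negligible ?S")
proof (subst negligible_on_intervals, intro allI)
  fix a b :: real
  define A where "A = ?S \<inter> cbox a b"
  \<comment> \<open>\<open>A\<close> is not known to be measurable. Its measurable superset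
    \<open>G\<close> is what \<open>U\<close> approximates, and \<open>negligible_outer_le\<close>
    asks only for small measurable supersets of \<open>A\<close>.\<close>
  define G where "G = {x \<in> cbox a b. f x \<le> r}"
  \<comment> \<open>Off \<open>G\<close> the bound \<open>f \<le> C \<le> r + k\<close>
    remains.\<close>
  define k where "k = C + \<bar>r\<bar>"
  have "C \<ge> 0" using f(2)[of 0] by linarith
  then have "k \<ge> 0" by (simp add: k_def)
  have "{x \<in> space lebesgue. f x \<le> r} \<in> sets lebesgue"
    using f(1) by measurable
  then have "G \<in> sets lebesgue"
    unfolding G_def by (simp add: Collect_conj_eq sets.Int)
  have "A \<subseteq> G" by (auto simp: A_def G_def)
  show "negligible A"
    unfolding negligible_outer_le
  proof (intro allI impI)
    fix e :: real assume "e > 0"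
    \<comment> \<open>Chosen for \<open>(k + 1) * \<eta> = (r' - r) * e\<close>.\<close>
    define \<eta> where "\<eta> = e * (r' - r) / (k + 1)"
    have "\<eta> > 0" using \<open>e > 0\<close> \<open>r < r'\<close> \<open>k \<ge> 0\<close> by (simp add: \<eta>_def)
    obtain U where U: "open U" "G \<subseteq> U" "U - G \<in> lmeasurable" "emeasure lebesgue (U - G) < ennreal \<eta>"
      using sets_lebesgue_outer_open[OF \<open>G \<in> sets lebesgue\<close> \<open>\<eta> > 0\<close>] by blast
    have mU: "measure lebesgue (U - G) < \<eta>"
      using U(3,4) \<open>\<eta> > 0\<close> by (simp add: emeasure_eq_measure2 ennreal_less_iff)
    define K where "K = {(u, v). u < v \<and> {u..v} \<subseteq> U \<and> integral {u..v} f > r' * (v - u)}"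
    define c where "c = (\<lambda>(u::real, v). (u + v) / 2)"
    define \<rho> where "\<rho> = (\<lambda>(u::real, v). (v - u) / 2)"
    have ball: "cball (c i) (\<rho> i) = {fst i..snd i}" for i
      by (cases i) (auto simp: c_def \<rho>_def cball_eq_atLeastAtMost field_simps)
    have \<rho>: "0 < \<rho> i" if "i \<in> K" for i using that by (auto simp: K_def \<rho>_def)
    have cover: "\<exists>i. i \<in> K \<and> x \<in> cball (c i) (\<rho> i) \<and> \<rho> i < d" if "x \<in> A" "0 < d" for x d
    proof -
      have "x \<in> U" using \<open>A \<subseteq> G\<close> U(2) that(1) by blast
      then obtain d' where d': "d' > 0" "ball x d' \<subseteq> U" using U(1) openE by blast
      obtain u v where uv: "u \<le> x" "x \<le> v" "u < v" "v - u < min d d'" "integral {u..v} f > r' * (v - u)"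
      proof -
        have "\<forall>d>0. \<exists>u v. u \<le> x \<and> x \<le> v \<and> u < v \<and> v - u < d \<and> integral {u..v} f > r' * (v - u)"
          using \<open>x \<in> A\<close> by (simp add: A_def)
        from this[rule_format, of "min d d'"] show thesis
          using d'(1) \<open>0 < d\<close> that by auto
      qed
      have "{u..v} \<subseteq> ball x d'" using uv by (auto simp: dist_real_def)
      then have "(u, v) \<in> K" using uv d'(2) by (auto simp: K_def)
      moreover have "\<rho> (u, v) < d" using uv(3,4) by (simp add: \<rho>_def)
      ultimately show ?thesis using uv(1,2) ball by (intro exI[of _ "(u, v)"]) auto
    qed
    obtain D where D: "countable D" "D \<subseteq> K"
      "pairwise (\<lambda>i j. disjnt (cball (c i) (\<rho> i)) (cball (c j) (\<rho> j))) D"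
      "negligible (A - (\<Union>i\<in>D. cball (c i) (\<rho> i)))"
      using Vitali_covering_theorem_cballs[OF \<rho> cover] by blast
    \<comment> \<open>The average exceeds \<open>r'\<close> although \<open>f \<le> r\<close> on
      \<open>G\<close>, so the excess comes from the part outside \<open>G\<close>, where
      \<open>f \<le> r + k\<close>. Each chosen interval thus spends a fixed fraction of its length
      there.\<close>
    have len: "(r' - r) * (snd i - fst i) \<le> k * measure lebesgue ({fst i..snd i} - G)" if "i \<in> K" for i
    proof -
      obtain u v where i: "i = (u, v)" by (cases i)
      have uv: "u < v" "integral {u..v} f > r' * (v - u)" using that by (auto simp: K_def i)
      have eq: "(- G) \<inter> {u..v} = {u..v} - G" by blast
      have m: "(- G) \<inter> {u..v} \<in> lmeasurable"
        unfolding eq using \<open>G \<in> sets lebesgue\<close>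
        by (intro bounded_set_imp_lmeasurable bounded_subset[OF bounded_closed_interval]) auto
      have ind: "(indicator (- G) :: real \<Rightarrow> real) integrable_on {u..v}"
        using m by (simp add: integrable_on_indicator)
      have ucv: "(\<lambda>_. r) integrable_on {u..v}" by (rule integrable_const_ivl)
      have le: "f x \<le> r + k * indicator (- G) x" if "x \<in> {u..v}" for x
      proof (cases "x \<in> G")
        case True then show ?thesis by (simp add: G_def)
      next
        case False
        moreover have "f x \<le> C" using f(2)[of x] by linarith
        ultimately show ?thesis by (simp add: k_def)
      qed
      have "integral {u..v} f \<le> integral {u..v} (\<lambda>x. r + k * indicator (- G) x)"
        using ind bounded_measurable_integrable_on[OF f] le
        by (intro integral_le integrable_add ucv integrable_on_mult_right) auto
      also have "\<dots> = integral {u..v} (\<lambda>x. r) + integral {u..v} (\<lambda>x. k * indicator (- G) x)"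
        using ind by (intro Henstock_Kurzweil_Integration.integral_add ucv integrable_on_mult_right)
      also have "\<dots> = r * (v - u) + k * measure lebesgue ((- G) \<inter> {u..v})"
        using uv(1) m by (simp add: integral_indicator)
      finally have "r' * (v - u) \<le> r * (v - u) + k * measure lebesgue ((- G) \<inter> {u..v})"
        using uv(2) by simp
      then show ?thesis by (simp add: i eq algebra_simps)
    qed
    \<comment> \<open>By disjointness the parts outside \<open>G\<close> add up inside
      \<open>U - G\<close>. The bound does not depend on \<open>F\<close>, so it passes to the
      countable union.\<close>
    have fin: "measure lebesgue (\<Union>i\<in>F. {fst i..snd i}) \<le> e" if F: "F \<subseteq> D" "finite F" for F
    proof -
      have sub: "{fst i..snd i} \<subseteq> U" "fst i < snd i" if "i \<in> F" for i
      proof -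
        have "i \<in> K" using that F(1) D(2) by blast
        then show "{fst i..snd i} \<subseteq> U" "fst i < snd i" by (auto simp: K_def)
      qed
      have disj: "disjoint_family_on (\<lambda>i. {fst i..snd i} - G) F"
        unfolding disjoint_family_on_def
      proof (intro ballI impI)
        fix i j assume "i \<in> F" "j \<in> F" "i \<noteq> j"
        then have "disjnt {fst i..snd i} {fst j..snd j}"
          using pairwiseD[OF D(3), of i j] F(1) by (auto simp: ball)
        then show "({fst i..snd i} - G) \<inter> ({fst j..snd j} - G) = {}"
          unfolding disjnt_def by blast
      qed
      have meas: "{fst i..snd i} - G \<in> lmeasurable" for i
        using \<open>G \<in> sets lebesgue\<close> by (intro bounded_set_imp_lmeasurable bounded_subset[OF bounded_closed_interval]) auto
      have "(r' - r) * measure lebesgue (\<Union>i\<in>F. {fst i..snd i})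
          \<le> (r' - r) * (\<Sum>i\<in>F. measure lebesgue {fst i..snd i})"
        using F(2) \<open>r < r'\<close> by (intro mult_left_mono measure_UNION_le) auto
      also have "\<dots> = (\<Sum>i\<in>F. (r' - r) * (snd i - fst i))"
        unfolding sum_distrib_left using sub(2) by (intro sum.cong refl) (simp add: less_imp_le)
      also have "\<dots> \<le> (\<Sum>i\<in>F. k * measure lebesgue ({fst i..snd i} - G))"
        using F(1) D(2) by (intro sum_mono len) auto
      also have "\<dots> = k * measure lebesgue (\<Union>i\<in>F. {fst i..snd i} - G)"
      proof -
        have "measure lebesgue (\<Union>i\<in>F. {fst i..snd i} - G)
            = (\<Sum>i\<in>F. measure lebesgue ({fst i..snd i} - G))"
          by (rule measure_finite_Union[OF F(2) image_subsetI[OF fmeasurableD[OF meas]] disj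
                fmeasurableD2[OF meas, folded infinity_ennreal_def]])
        then show ?thesis by (simp only: sum_distrib_left)
      qed
      also have "\<dots> \<le> k * measure lebesgue (U - G)"
        using sub meas F(2) U(3) \<open>k \<ge> 0\<close>
        by (intro mult_left_mono measure_mono_fmeasurable sets.finite_UN) (auto simp: fmeasurableD)
      also have "\<dots> \<le> (k + 1) * \<eta>"
        using mU \<open>k \<ge> 0\<close> by (intro mult_mono) auto
      also have "\<dots> = (r' - r) * e" using \<open>k \<ge> 0\<close> by (simp add: \<eta>_def)
      finally show ?thesis using \<open>r < r'\<close> by simp
    qed
    define W where "W = (\<Union>i\<in>D. {fst i..snd i})"
    have W: "W \<in> lmeasurable" "measure lebesgue W \<le> e"
      unfolding W_def using fin by (auto intro!: fmeasurable_UN_bound[OF D(1)] measure_UN_bound[OF D(1)])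
    have N: "A - W \<in> lmeasurable" "measure lebesgue (A - W) = 0"
      using D(4) negligible_imp_measurable negligible_imp_measure0 by (auto simp: ball W_def)
    have "measure lebesgue ((A - W) \<union> W) \<le> measure lebesgue (A - W) + measure lebesgue W"
      using N W by (intro measure_Un_le) (auto simp: fmeasurableD)
    then show "\<exists>T. A \<subseteq> T \<and> T \<in> lmeasurable \<and> measure lebesgue T \<le> e"
      using N(2) W(2) fmeasurable.Un[OF N(1) W(1)] by (intro exI[of _ "(A - W) \<union> W"]) auto
  qed
qed

text \<open>If the estimate fails at \<open>x\<close> for some \<open>\<epsilon>\<close>, rationals
  \<open>p < q\<close> between \<open>f x\<close> and \<open>f x + \<epsilon>\<close> place
  \<open>x\<close> in one of countably many null sets given by
  \<open>negligible_large_averages\<close>.\<close>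

lemma AE_averages_le:
  fixes f :: "real \<Rightarrow> real"
  assumes f: "f \<in> borel_measurable lebesgue" "\<And>t. \<bar>f t\<bar> \<le> C"
  shows "AE x in lebesgue. \<forall>\<epsilon>>0. \<exists>d>0. \<forall>u v. u \<le> x \<longrightarrow> x \<le> v \<longrightarrow> u < v \<longrightarrow> v - u < d \<longrightarrow>
    integral {u..v} f \<le> (f x + \<epsilon>) * (v - u)"
proof -
  have "AE x in lebesgue. \<forall>p q :: rat. p < q \<longrightarrow> x \<notin> {x. f x \<le> of_rat p \<and>
      (\<forall>d>0. \<exists>u v. u \<le> x \<and> x \<le> v \<and> u < v \<and> v - u < d \<and> integral {u..v} f > of_rat q * (v - u))}"
  proof (subst AE_all_countable, intro allI, subst AE_all_countable, intro allI)
    fix p q :: rat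
    show "AE x in lebesgue. p < q \<longrightarrow> x \<notin> {x. f x \<le> of_rat p \<and>
      (\<forall>d>0. \<exists>u v. u \<le> x \<and> x \<le> v \<and> u < v \<and> v - u < d \<and> integral {u..v} f > of_rat q * (v - u))}"
    proof (cases "p < q")
      case True
      then have "(of_rat p :: real) < of_rat q" by (simp add: of_rat_less)
      from negligible_large_averages[OF f this] True show ?thesis
        unfolding negligible_iff_null_sets by (auto dest: AE_not_in)
    qed simp
  qed
  then show ?thesis
  proof (rule eventually_mono, intro allI impI)
    fix x \<epsilon> :: real
    assume x: "\<forall>p q :: rat. p < q \<longrightarrow> x \<notin> {x. f x \<le> of_rat p \<and>
      (\<forall>d>0. \<exists>u v. u \<le> x \<and> x \<le> v \<and> u < v \<and> v - u < d \<and> integral {u..v} f > of_rat q * (v - u))}"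
      and "\<epsilon> > 0"
    obtain p where p: "f x < of_rat p" "of_rat p < f x + \<epsilon>"
      using of_rat_dense[of "f x" "f x + \<epsilon>"] \<open>\<epsilon> > 0\<close> by auto
    obtain q where q: "of_rat p < (of_rat q :: real)" "of_rat q < f x + \<epsilon>"
      using of_rat_dense[OF p(2)] by auto
    have "p < q" using q(1) by (simp add: of_rat_less)
    then have "\<not> (f x \<le> of_rat p \<and> (\<forall>d>0. \<exists>u v. u \<le> x \<and> x \<le> v \<and> u < v \<and> v - u < d \<and>
        integral {u..v} f > of_rat q * (v - u)))"
      using x by blast
    then obtain d where "d > 0" and d: "\<And>u v. u \<le> x \<Longrightarrow> x \<le> v \<Longrightarrow> u < v \<Longrightarrow> v - u < d \<Longrightarrow>
        \<not> integral {u..v} f > of_rat q * (v - u)"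
      using less_imp_le[OF p(1)] by blast
    have "integral {u..v} f \<le> (f x + \<epsilon>) * (v - u)" if "u \<le> x" "x \<le> v" "u < v" "v - u < d" for u v
    proof -
      have "integral {u..v} f \<le> of_rat q * (v - u)" using d[OF that] by simp
      also have "\<dots> \<le> (f x + \<epsilon>) * (v - u)" using q(2) that(3) by (intro mult_right_mono) auto
      finally show ?thesis .
    qed
    then show "\<exists>d>0. \<forall>u v. u \<le> x \<longrightarrow> x \<le> v \<longrightarrow> u < v \<longrightarrow> v - u < d \<longrightarrow>
        integral {u..v} f \<le> (f x + \<epsilon>) * (v - u)"
      using \<open>d > 0\<close> by blast
  qed
qed

text \<open>The one-sided bound on averages is applied to \<open>f\<close> and to its negative;
  intervals having \<open>x\<close> as an endpoint give the difference quotients.\<close>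

lemma lebesgue_differentiation_bounded:
  fixes f :: "real \<Rightarrow> real"
  assumes f: "f \<in> borel_measurable lebesgue" "\<And>t. \<bar>f t\<bar> \<le> C"
  shows "AE x in lebesgue. x > s \<longrightarrow> ((\<lambda>t. integral {s..t} f) has_real_derivative f x) (at x)"
proof -
  have g: "(\<lambda>t. - f t) \<in> borel_measurable lebesgue" "\<bar>- f t\<bar> \<le> C" for t
    using f by auto
  from AE_averages_le[OF f] AE_averages_le[OF g] show ?thesis
  proof (rule eventually_elim2, intro impI)
    fix x assume upper: "\<forall>\<epsilon>>0. \<exists>d>0. \<forall>u v. u \<le> x \<longrightarrow> x \<le> v \<longrightarrow> u < v \<longrightarrow> v - u < d \<longrightarrow>
        integral {u..v} f \<le> (f x + \<epsilon>) * (v - u)"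
      and lower: "\<forall>\<epsilon>>0. \<exists>d>0. \<forall>u v. u \<le> x \<longrightarrow> x \<le> v \<longrightarrow> u < v \<longrightarrow> v - u < d \<longrightarrow>
        integral {u..v} (\<lambda>t. - f t) \<le> (- f x + \<epsilon>) * (v - u)" and "s < x"
    show "((\<lambda>t. integral {s..t} f) has_real_derivative f x) (at x)"
      unfolding has_field_derivative_def has_derivative_at_alt
    proof (intro conjI allI impI bounded_linear_mult_right)
      fix \<epsilon> :: real assume "\<epsilon> > 0"
      obtain d1 where d1: "d1 > 0" "\<And>u v. u \<le> x \<Longrightarrow> x \<le> v \<Longrightarrow> u < v \<Longrightarrow> v - u < d1 \<Longrightarrow>
        integral {u..v} f \<le> (f x + \<epsilon>) * (v - u)" using upper \<open>\<epsilon> > 0\<close> by blast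
      obtain d2 where d2: "d2 > 0" "\<And>u v. u \<le> x \<Longrightarrow> x \<le> v \<Longrightarrow> u < v \<Longrightarrow> v - u < d2 \<Longrightarrow>
        integral {u..v} (\<lambda>t. - f t) \<le> (- f x + \<epsilon>) * (v - u)" using lower \<open>\<epsilon> > 0\<close> by blast
      \<comment> \<open>The bound \<open>x - s\<close> keeps \<open>y\<close> to the right of
        \<open>s\<close>; to the left of \<open>s\<close> the integral runs over an empty
        interval.\<close>
      define d where "d = min (min d1 d2) (x - s)"
      have main: "\<bar>integral {u..v} f - f x * (v - u)\<bar> \<le> \<epsilon> * (v - u)"
        if "u \<le> x" "x \<le> v" "u < v" "v - u < d" for u v
        using d1(2)[of u v] d2(2)[of u v] that by (simp add: d_def algebra_simps abs_le_iff)
      have "norm (integral {s..y} f - integral {s..x} f - f x * (y - x)) \<le> \<epsilon> * norm (y - x)"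
        if "norm (y - x) < d" for y
      proof -
        consider "y = x" | "x < y" | "s < y" "y < x" using \<open>norm (y - x) < d\<close> unfolding d_def real_norm_def by linarith
        then show ?thesis
        proof cases
          case 2
          then show ?thesis
            using main[of x y] that bounded_measurable_integral_lipschitz(1)[OF f, of s x y] \<open>s < x\<close>
            by simp
        next
          case 3
          have "integral {s..y} f - integral {s..x} f - f x * (y - x)
              = - (integral {y..x} f - f x * (x - y))"
            using bounded_measurable_integral_lipschitz(1)[OF f, of s y x] 3
            by (simp add: algebra_simps)
          then show ?thesis using main[of y x] that 3 by simp
        qed simp
      qed
      moreover have "d > 0" using d1(1) d2(1) \<open>s < x\<close> by (simp add: d_def)
      ultimately show "\<exists>d>0. \<forall>y. norm (y - x) < d \<longrightarrow>
          norm (integral {s..y} f - integral {s..x} f - f x * (y - x)) \<le> \<epsilon> * norm (y - x)"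
        by blast
    qed
  qed
qed

text \<open>The integrands of the fixed point construction may grow exponentially; cutting them off
  beyond \<open>n\<close> brings them under the results for bounded functions.\<close>

lemma locally_bounded_truncation:
  fixes f :: "real \<Rightarrow> real"
  assumes "f \<in> borel_measurable lebesgue" "\<And>n. \<exists>C. \<forall>t\<le>n. \<bar>f t\<bar> \<le> C"
  obtains f' C where "f' \<in> borel_measurable lebesgue" "\<And>t. \<bar>f' t\<bar> \<le> C" "\<And>t. t \<le> n \<Longrightarrow> f' t = f t"
    "\<And>u v. v \<le> n \<Longrightarrow> integral {u..v} f' = integral {u..v} f"
    "\<And>u v. v \<le> n \<Longrightarrow> f integrable_on {u..v}"
proof -
  obtain C where C: "\<And>t. t \<le> n \<Longrightarrow> \<bar>f t\<bar> \<le> C" using assms(2) by blast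
  define f' where "f' t = indicator {..n} t * f t" for t
  have f': "f' \<in> borel_measurable lebesgue"
    unfolding f'_def using assms(1) by (intro borel_measurable_times borel_measurable_indicator) auto
  have bd: "\<bar>f' t\<bar> \<le> \<bar>C\<bar>" for t
    using C[of t] by (auto simp: f'_def indicator_def)
  have eq: "f' t = f t" if "t \<le> n" for t using that by (simp add: f'_def)
  have int: "integral {u..v} f' = integral {u..v} f" if "v \<le> n" for u v
    using that by (intro Henstock_Kurzweil_Integration.integral_cong eq) auto
  have "f integrable_on {u..v}" if "v \<le> n" for u v
    by (rule integrable_eq[OF bounded_measurable_integrable_on[OF f' bd]]) (use that eq in auto)
  from that[OF f' bd eq int this] show ?thesis .
qed

lemma
  fixes f :: "real \<Rightarrow> real"
  assumes f: "f \<in> borel_measurable lebesgue" "\<And>n. \<exists>C. \<forall>t\<le>n. \<bar>f t\<bar> \<le> C"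
  shows locally_bounded_integrable_on: "f integrable_on {u..v}"
    and locally_bounded_integral_ac: "abs_continuous_interval (\<lambda>t. integral {s..t} f) s v"
    and locally_bounded_integral_deriv:
      "AE x in lebesgue. x > s \<longrightarrow> ((\<lambda>t. integral {s..t} f) has_real_derivative f x) (at x)"
proof -
  obtain f' C where f': "f' \<in> borel_measurable lebesgue" "\<And>t. \<bar>f' t\<bar> \<le> C"
    "\<And>u w. w \<le> v \<Longrightarrow> integral {u..w} f' = integral {u..w} f" "f integrable_on {u..v}"
    using locally_bounded_truncation[OF f, of v] by (metis order_refl)
  show "f integrable_on {u..v}" by fact
  show "abs_continuous_interval (\<lambda>t. integral {s..t} f) s v"
  proof (rule ac_lipschitz)
    fix r t assume "s \<le> r" "r \<le> t" "t \<le> v"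
    then show "\<bar>integral {s..t} f - integral {s..r} f\<bar> \<le> C * (t - r)"
      using bounded_measurable_integral_lipschitz[OF f'(1,2), of s r t] f'(3)[of t s] f'(3)[of r s]
      by simp
  qed
  have "AE x in lebesgue. x > s \<longrightarrow> x < real n \<longrightarrow> ((\<lambda>t. integral {s..t} f) has_real_derivative f x) (at x)"
    for n :: nat
  proof -
    obtain f' C where f': "f' \<in> borel_measurable lebesgue" "\<And>t. \<bar>f' t\<bar> \<le> C"
      "\<And>t. t \<le> real n \<Longrightarrow> f' t = f t"
      "\<And>u w. w \<le> real n \<Longrightarrow> integral {u..w} f' = integral {u..w} f"
      using locally_bounded_truncation[OF f, of "real n"] by metis
    show ?thesis
      using lebesgue_differentiation_bounded[OF f'(1,2), of s]
    proof (rule eventually_mono, intro impI)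
      fix x assume "s < x \<longrightarrow> ((\<lambda>t. integral {s..t} f') has_real_derivative f' x) (at x)"
        and x: "s < x" "x < real n"
      then have "((\<lambda>t. integral {s..t} f') has_real_derivative f x) (at x)"
        using f'(3)[of x] by simp
      then show "((\<lambda>t. integral {s..t} f) has_real_derivative f x) (at x)"
        by (rule has_field_derivative_transform_within_open[where S="{..<real n}"])
          (use x f'(4) in auto)
    qed
  qed
  then have "AE x in lebesgue. \<forall>n::nat. x > s \<longrightarrow> x < real n \<longrightarrow>
      ((\<lambda>t. integral {s..t} f) has_real_derivative f x) (at x)"
    by (subst AE_all_countable) blast
  then show "AE x in lebesgue. x > s \<longrightarrow> ((\<lambda>t. integral {s..t} f) has_real_derivative f x) (at x)"
    by (rule eventually_mono) (meson reals_Archimedean2)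
qed

subsection \<open>Existence and uniqueness of solutions\<close>

text \<open>Banach's fixed point theorem in the weighted space of functions \<open>x\<close> on \<open>{s..}\<close> for which
  \<open>g t = exp (- \<kappa> (t - s)) x t\<close> is bounded.\<close>

lemma retarded_solution_exists:
  fixes \<alpha> \<eta> :: "'k \<Rightarrow> real \<Rightarrow> real"
  assumes \<alpha>: "\<And>k. k \<in> K \<Longrightarrow> \<alpha> k \<in> borel_measurable lebesgue"
    and C: "\<And>k t. k \<in> K \<Longrightarrow> \<bar>\<alpha> k t\<bar> \<le> C k"
    and \<eta>: "\<And>k. k \<in> K \<Longrightarrow> \<eta> k \<in> borel_measurable lebesgue"
    and \<eta>_le: "\<And>k t. k \<in> K \<Longrightarrow> s \<le> t \<Longrightarrow> \<eta> k t \<le> t"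
  obtains x where "\<And>t. t < s \<Longrightarrow> x t = 0" "x s = (1::real)" "\<And>v. abs_continuous_interval x s v"
    "AE t in lebesgue. t > s \<longrightarrow> (x has_real_derivative - (\<Sum>k\<in>K. \<alpha> k t * x (\<eta> k t))) (at t)"
proof -
  define A where "A = (\<Sum>k\<in>K. C k)"
  have C0: "0 \<le> C k" if "k \<in> K" for k using C[OF that, of 0] by linarith
  have "A \<ge> 0" unfolding A_def by (intro sum_nonneg C0)
  \<comment> \<open>Then \<open>A / \<kappa> \<le> 1 / 2\<close>, the contraction constant.\<close>
  define \<kappa> where "\<kappa> = 2 * A + 1"
  have "\<kappa> > 0" using \<open>A \<ge> 0\<close> by (simp add: \<kappa>_def)
  \<comment> \<open>The sum in the equation, written in terms of \<open>g\<close>. Arguments before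
    \<open>s\<close> contribute the zero history, and the condition \<open>s \<le> u\<close> makes
    \<open>G g\<close> bounded on left half-lines.\<close>
  define G :: "(real \<Rightarrow>\<^sub>C real) \<Rightarrow> real \<Rightarrow> real" where
    "G g u = (\<Sum>k\<in>K. if s \<le> u \<and> s \<le> \<eta> k u then \<alpha> k u * (exp (\<kappa> * (\<eta> k u - s)) * g (\<eta> k u)) else 0)"
    for g u
  have G_meas: "G g \<in> borel_measurable lebesgue" for g
    unfolding G_def
  proof (intro borel_measurable_sum measurable_If borel_measurable_times \<alpha>)
    fix k assume k: "k \<in> K"
    note [measurable] = \<eta>[OF k]
    have [measurable]: "(\<lambda>y. g y) \<in> borel_measurable borel"
      by (intro borel_measurable_continuous_onI) simp
    show "(\<lambda>u. exp (\<kappa> * (\<eta> k u - s))) \<in> borel_measurable lebesgue" by measurable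
    show "(\<lambda>u. g (\<eta> k u)) \<in> borel_measurable lebesgue" by measurable
    have "{u \<in> space lebesgue. s \<le> \<eta> k u} \<in> sets lebesgue"
      using \<eta>[OF k] by (simp add: borel_measurable_iff_ge)
    moreover have "{u \<in> space lebesgue. s \<le> u \<and> s \<le> \<eta> k u} = {s..} \<inter> {u \<in> space lebesgue. s \<le> \<eta> k u}"
      by auto
    ultimately show "{u \<in> space lebesgue. s \<le> u \<and> s \<le> \<eta> k u} \<in> sets lebesgue" by auto
  qed auto
  \<comment> \<open>Here \<open>\<eta> k u \<le> u\<close> enters: the weight at the delayed
    argument is at most the weight at \<open>u\<close>, whose integral then gains the factor
    \<open>1 / \<kappa>\<close>.\<close>
  have G_dist: "\<bar>G g u - G g' u\<bar> \<le> A * exp (\<kappa> * (u - s)) * dist g g'" for g g' u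
  proof -
    have "\<bar>G g u - G g' u\<bar> \<le> (\<Sum>k\<in>K. C k * (exp (\<kappa> * (u - s)) * dist g g'))"
      unfolding G_def sum_subtractf[symmetric]
    proof (rule order_trans[OF sum_abs sum_mono])
      fix k assume k: "k \<in> K"
      show "\<bar>(if s \<le> u \<and> s \<le> \<eta> k u then \<alpha> k u * (exp (\<kappa> * (\<eta> k u - s)) * g (\<eta> k u)) else 0) -
         (if s \<le> u \<and> s \<le> \<eta> k u then \<alpha> k u * (exp (\<kappa> * (\<eta> k u - s)) * g' (\<eta> k u)) else 0)\<bar>
         \<le> C k * (exp (\<kappa> * (u - s)) * dist g g')" (is "\<bar>?l - ?r\<bar> \<le> _")
      proof (cases "s \<le> u \<and> s \<le> \<eta> k u")
        case True
        have "?l - ?r = \<alpha> k u * (exp (\<kappa> * (\<eta> k u - s)) * (g (\<eta> k u) - g' (\<eta> k u)))"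
          using True by (simp add: algebra_simps)
        also have "\<bar>\<dots>\<bar> = \<bar>\<alpha> k u\<bar> * (exp (\<kappa> * (\<eta> k u - s)) * dist (g (\<eta> k u)) (g' (\<eta> k u)))"
          by (simp add: abs_mult dist_real_def)
        also have "\<dots> \<le> C k * (exp (\<kappa> * (u - s)) * dist g g')"
          using C[OF k] C0[OF k] \<eta>_le[OF k] True \<open>\<kappa> > 0\<close>
          by (intro mult_mono dist_bounded) auto
        finally show ?thesis .
      next
        case False
        have "0 \<le> C k * (exp (\<kappa> * (u - s)) * dist g g')" using C0[OF k] by simp
        then show ?thesis using False by auto
      qed
    qed
    also have "\<dots> = A * exp (\<kappa> * (u - s)) * dist g g'"
      by (simp add: A_def sum_distrib_right mult.assoc)
    finally show ?thesis .
  qed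
  have G0: "G 0 u = 0" for u by (simp add: G_def cong: if_cong)
  have G_bdd: "\<exists>C. \<forall>u\<le>n. \<bar>G g u\<bar> \<le> C" for g n
  proof (intro exI allI impI)
    fix u assume "u \<le> n"
    have "\<bar>G g u\<bar> \<le> A * exp (\<kappa> * (u - s)) * dist g 0" using G_dist[of g u 0] G0 by simp
    also have "\<dots> \<le> A * exp (\<kappa> * (n - s)) * dist g 0"
      using \<open>A \<ge> 0\<close> \<open>\<kappa> > 0\<close> \<open>u \<le> n\<close> by (intro mult_right_mono mult_left_mono) auto
    finally show "\<bar>G g u\<bar> \<le> A * exp (\<kappa> * (n - s)) * dist g 0" .
  qed
  have G_int: "G g integrable_on {u..v}" for g u v
    by (rule locally_bounded_integrable_on[OF G_meas G_bdd])
  define F where "F g t = integral {s..t} (G g)" for g t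
  have F_ac: "abs_continuous_interval (F g) s v" for g v
    unfolding F_def by (rule locally_bounded_integral_ac[OF G_meas G_bdd])
  have F_dist: "\<bar>F g t - F g' t\<bar> \<le> exp (\<kappa> * (t - s)) * (dist g g' / 2)" if "s \<le> t" for g g' t
  proof -
    have exp_int: "((\<lambda>u. exp (\<kappa> * (u - s))) has_integral
        exp (\<kappa> * (t - s)) / \<kappa> - exp (\<kappa> * (s - s)) / \<kappa>) {s..t}"
      using \<open>\<kappa> > 0\<close> that
      by (intro fundamental_theorem_of_calculus)
        (auto intro!: derivative_eq_intros simp: has_real_derivative_iff_has_vector_derivative[symmetric])
    then have bound_int: "((\<lambda>u. A * exp (\<kappa> * (u - s)) * dist g g') has_integral
        A * (exp (\<kappa> * (t - s)) / \<kappa> - 1 / \<kappa>) * dist g g') {s..t}"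
      by (auto intro!: has_integral_mult_left has_integral_mult_right)
    have "F g t - F g' t = integral {s..t} (\<lambda>u. G g u - G g' u)"
      unfolding F_def by (simp add: Henstock_Kurzweil_Integration.integral_diff G_int)
    also have "norm \<dots> \<le> integral {s..t} (\<lambda>u. A * exp (\<kappa> * (u - s)) * dist g g')"
      using G_dist bound_int
      by (intro integral_norm_bound_integral integrable_diff G_int) (auto simp: has_integral_integrable)
    also have "\<dots> = A * (exp (\<kappa> * (t - s)) / \<kappa> - 1 / \<kappa>) * dist g g'"
      using bound_int by (rule integral_unique)
    also have "\<dots> \<le> A * (exp (\<kappa> * (t - s)) / \<kappa>) * dist g g'"
      using \<open>A \<ge> 0\<close> \<open>\<kappa> > 0\<close> by (intro mult_right_mono mult_left_mono) auto
    also have "\<dots> = exp (\<kappa> * (t - s)) * (A / \<kappa> * dist g g')" by simp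
    also have "\<dots> \<le> exp (\<kappa> * (t - s)) * (1 / 2 * dist g g')"
      using \<open>A \<ge> 0\<close> by (intro mult_left_mono mult_right_mono) (auto simp: \<kappa>_def field_simps)
    finally show ?thesis by simp
  qed
  have F0: "F 0 t = 0" for t
  proof -
    have "G 0 = (\<lambda>_. 0)" using G0 by blast
    then show ?thesis by (simp add: F_def)
  qed
  have cancel: "exp y * c * exp (- y) = c" for y c :: real by (simp add: exp_minus)
  \<comment> \<open>Freezing the argument at \<open>s\<close> gives a bounded continuous function on
    the whole line, with value 1 to the left of \<open>s\<close>.\<close>
  define p where "p g t = (1 - F g (max t s)) * exp (- (\<kappa> * (max t s - s)))" for g t
  have p_cont: "p g \<in> bcontfun" for g
  proof (rule bcontfun_normI)
    have "continuous_on {..<n} (p g)" for n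
      unfolding p_def
      by (intro continuous_intros continuous_on_compose2[OF ac_continuous_on[OF F_ac[of _ "max n s"]]]) auto
    then have "isCont (p g) t" for t
      using continuous_on_eq_continuous_at[OF open_lessThan, of "t + 1" "p g"] by auto
    then show "continuous_on UNIV (p g)" by (simp add: continuous_at_imp_continuous_on)
    fix t
    have "\<bar>F g (max t s)\<bar> \<le> exp (\<kappa> * (max t s - s)) * (dist g 0 / 2)"
      using F_dist[of "max t s" g 0] F0 by simp
    then have "\<bar>F g (max t s)\<bar> * exp (- (\<kappa> * (max t s - s)))
        \<le> exp (\<kappa> * (max t s - s)) * (dist g 0 / 2) * exp (- (\<kappa> * (max t s - s)))"
      by (intro mult_right_mono) auto
    then have "\<bar>F g (max t s)\<bar> * exp (- (\<kappa> * (max t s - s))) \<le> dist g 0 / 2"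
      unfolding cancel .
    moreover have "1 * exp (- (\<kappa> * (max t s - s))) \<le> 1" using \<open>\<kappa> > 0\<close> by simp
    moreover have "norm (p g t) \<le> (1 + \<bar>F g (max t s)\<bar>) * exp (- (\<kappa> * (max t s - s)))"
      unfolding p_def norm_mult by (intro mult_mono) auto
    ultimately show "norm (p g t) \<le> 1 + dist g 0 / 2" unfolding distrib_right by linarith
  qed
  define P where "P g = Bcontfun (p g)" for g
  have P: "apply_bcontfun (P g) = p g" for g
    unfolding P_def using p_cont by (rule Bcontfun_inverse)
  have "dist (P g) (P g') \<le> 1 / 2 * dist g g'" for g g'
  proof (rule dist_bound)
    fix t
    have "dist (P g t) (P g' t) = \<bar>(F g' (max t s) - F g (max t s)) * exp (- (\<kappa> * (max t s - s)))\<bar>"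
      by (simp add: P p_def dist_real_def algebra_simps)
    also have "\<dots> = \<bar>F g (max t s) - F g' (max t s)\<bar> * exp (- (\<kappa> * (max t s - s)))"
      by (simp add: abs_mult abs_minus_commute)
    also have "\<dots> \<le> exp (\<kappa> * (max t s - s)) * (dist g g' / 2) * exp (- (\<kappa> * (max t s - s)))"
      using F_dist[of "max t s" g g'] by (intro mult_right_mono) auto
    also have "\<dots> = 1 / 2 * dist g g'" unfolding cancel by simp
    finally show "dist (P g t) (P g' t) \<le> 1 / 2 * dist g g'" .
  qed
  then obtain g where g: "P g = g"
    using banach_fix_type[of "1/2" P] by auto
  define x where "x t = (if t < s then 0 else 1 - F g t)" for t
  have gx: "exp (\<kappa> * (t - s)) * g t = x t" if "s \<le> t" for t
  proof -
    have "g t = (1 - F g t) * exp (- (\<kappa> * (t - s)))"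
      using P[of g] g that by (simp add: p_def max_def)
    then have "exp (\<kappa> * (t - s)) * g t = exp (\<kappa> * (t - s)) * (1 - F g t) * exp (- (\<kappa> * (t - s)))"
      by simp
    then show ?thesis unfolding cancel using that by (simp add: x_def)
  qed
  have Gx: "G g t = (\<Sum>k\<in>K. \<alpha> k t * x (\<eta> k t))" if "s \<le> t" for t
    unfolding G_def using that by (intro sum.cong refl) (auto simp: gx x_def)
  show ?thesis
  proof (rule that)
    show "x t = 0" if "t < s" for t using that by (simp add: x_def)
    show "x s = 1" by (simp add: x_def F_def)
    show "abs_continuous_interval x s v" for v
      by (rule ac_cong[OF ac_diff[OF ac_const[of 1] F_ac[of g]]]) (simp add: x_def)
    have "AE t in lebesgue. t > s \<longrightarrow> (F g has_real_derivative G g t) (at t)"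
      unfolding F_def by (rule locally_bounded_integral_deriv[OF G_meas G_bdd])
    then show "AE t in lebesgue. t > s \<longrightarrow> (x has_real_derivative - (\<Sum>k\<in>K. \<alpha> k t * x (\<eta> k t))) (at t)"
    proof (rule eventually_mono, intro impI)
      fix t assume t: "s < t \<longrightarrow> (F g has_real_derivative G g t) (at t)" "s < t"
      then have "((\<lambda>t. 1 - F g t) has_real_derivative 0 - (\<Sum>k\<in>K. \<alpha> k t * x (\<eta> k t))) (at t)"
        using Gx[of t] by (intro DERIV_diff DERIV_const) simp
      then have "(x has_real_derivative 0 - (\<Sum>k\<in>K. \<alpha> k t * x (\<eta> k t))) (at t)"
        by (rule has_field_derivative_transform_within_open[where S="{s<..}"])
          (use t in \<open>auto simp: x_def\<close>)
      then show "(x has_real_derivative - (\<Sum>k\<in>K. \<alpha> k t * x (\<eta> k t))) (at t)" by simp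
    qed
  qed
qed

text \<open>Let \<open>G\<close> be the maximum of
  \<open>\<bar>x t\<bar> * exp (\<beta> T - \<beta> t)\<close>, attained at \<open>m\<close>. The
  barrier \<open>G * exp (\<beta> t - \<beta> T)\<close> dominates \<open>\<bar>x t\<bar>\<close>
  and touches it at \<open>m\<close>. If \<open>S < G\<close>, it also dominates the history and
  grows at least as fast as \<open>x\<close> and its negative, so the positive gap at
  \<open>T\<close> could never close. The quantifier over \<open>G\<close> in \<open>derx\<close>
  expresses a bound by the running supremum.\<close>

lemma gronwall_retarded:
  assumes "T \<le> U"
    and mono: "\<And>s t. T \<le> s \<Longrightarrow> s \<le> t \<Longrightarrow> t \<le> U \<Longrightarrow> \<beta> s \<le> \<beta> t"
    and ac\<beta>: "abs_continuous_interval \<beta> T U"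
    and der\<beta>: "AE t in lebesgue. T < t \<and> t < U \<longrightarrow> (\<beta> has_real_derivative b t) (at t)"
    and acx: "abs_continuous_interval x T U"
    and hist: "\<And>t. t \<le> T \<Longrightarrow> \<bar>x t\<bar> \<le> S"
    and derx: "AE t in lebesgue. T < t \<and> t < U \<longrightarrow> (\<exists>D. (x has_real_derivative D) (at t) \<and>
      (\<forall>G. (\<forall>s\<le>t. \<bar>x s\<bar> \<le> G) \<longrightarrow> \<bar>D\<bar> \<le> b t * G))"
  shows "\<bar>x U\<bar> \<le> S * exp (\<beta> U - \<beta> T)"
proof -
  have "S \<ge> 0" using hist[of T] by linarith
  define g where "g t = \<bar>x t\<bar> * exp (\<beta> T - \<beta> t)" for t
  have "continuous_on {T..U} g"
    unfolding g_def by (intro continuous_intros ac_continuous_on ac\<beta> acx)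
  then obtain m where m: "m \<in> {T..U}" "\<And>t. t \<in> {T..U} \<Longrightarrow> g t \<le> g m"
    using continuous_attains_sup[of "{T..U}" g] \<open>T \<le> U\<close> by auto
  define G where "G = g m"
  have x_le: "\<bar>x t\<bar> \<le> G * exp (\<beta> t - \<beta> T)" if "T \<le> t" "t \<le> U" for t
  proof -
    have "\<bar>x t\<bar> = g t * exp (\<beta> t - \<beta> T)"
      by (simp add: g_def mult.assoc exp_add[symmetric])
    also have "\<dots> \<le> G * exp (\<beta> t - \<beta> T)"
      using m(2)[of t] that by (intro mult_right_mono) (auto simp: G_def)
    finally show ?thesis .
  qed
  have "G \<le> S"
  proof (rule ccontr)
    assume "\<not> G \<le> S"
    then have "S < G" by simp
    \<comment> \<open>\<open>\<bar>x t\<bar>\<close> need not be differentiable, so both signs of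
      \<open>x\<close> are compared with the barrier.\<close>
    have step: "\<sigma> * x m - G * exp (\<beta> m - \<beta> T) \<le> \<sigma> * x T - G * exp (\<beta> T - \<beta> T)" if "\<bar>\<sigma>\<bar> = 1" for \<sigma>
    proof (rule ac_nonincreasing[where f="\<lambda>t. \<sigma> * x t - G * exp (\<beta> t - \<beta> T)"])
      show "abs_continuous_interval (\<lambda>t. \<sigma> * x t - G * exp (\<beta> t - \<beta> T)) T m"
        using m(1) by (intro ac_diff ac_cmult ac_exp ac_const ac_subinterval[OF acx] ac_subinterval[OF ac\<beta>]) auto
      show "AE t in lebesgue. T < t \<and> t < m \<longrightarrow>
          (\<exists>D\<le>0. ((\<lambda>t. \<sigma> * x t - G * exp (\<beta> t - \<beta> T)) has_real_derivative D) (at t))"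
        using der\<beta> derx
      proof (rule eventually_elim2, intro impI)
        fix t assume "T < t \<and> t < U \<longrightarrow> (\<beta> has_real_derivative b t) (at t)"
          and "T < t \<and> t < U \<longrightarrow> (\<exists>D. (x has_real_derivative D) (at t) \<and>
            (\<forall>G. (\<forall>s\<le>t. \<bar>x s\<bar> \<le> G) \<longrightarrow> \<bar>D\<bar> \<le> b t * G))"
          and "T < t \<and> t < m"
        then have t: "T < t" "t < U" and d\<beta>: "(\<beta> has_real_derivative b t) (at t)" using m(1) by auto
        obtain D where D: "(x has_real_derivative D) (at t)"
          "\<And>G. (\<forall>s\<le>t. \<bar>x s\<bar> \<le> G) \<Longrightarrow> \<bar>D\<bar> \<le> b t * G"
          using \<open>T < t \<and> t < U \<longrightarrow> (\<exists>D. _ D)\<close> t by blast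
        have "\<bar>x s\<bar> \<le> G * exp (\<beta> t - \<beta> T)" if "s \<le> t" for s
        proof (cases "T \<le> s")
          case True
          have "\<bar>x s\<bar> \<le> G * exp (\<beta> s - \<beta> T)" using True that t by (intro x_le) auto
          also have "\<dots> \<le> G * exp (\<beta> t - \<beta> T)"
            using mono[of s t] True that t \<open>S < G\<close> \<open>S \<ge> 0\<close> by (intro mult_left_mono) auto
          finally show ?thesis .
        next
          case False
          then have "\<bar>x s\<bar> \<le> G * 1" using hist[of s] \<open>S < G\<close> by simp
          also have "\<dots> \<le> G * exp (\<beta> t - \<beta> T)"
            using mono[of T t] t \<open>S < G\<close> \<open>S \<ge> 0\<close> by (intro mult_left_mono) auto
          finally show ?thesis .
        qed
        then have "\<bar>D\<bar> \<le> b t * (G * exp (\<beta> t - \<beta> T))" using D(2) by blast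
        moreover have "\<sigma> * D \<le> \<bar>D\<bar>" using \<open>\<bar>\<sigma>\<bar> = 1\<close> by (metis abs_ge_self abs_mult mult_1)
        moreover have "((\<lambda>t. \<sigma> * x t - G * exp (\<beta> t - \<beta> T)) has_real_derivative
            \<sigma> * D - G * (exp (\<beta> t - \<beta> T) * b t)) (at t)"
          by (auto intro!: derivative_eq_intros D(1) d\<beta>)
        ultimately show "\<exists>D\<le>0. ((\<lambda>t. \<sigma> * x t - G * exp (\<beta> t - \<beta> T)) has_real_derivative D) (at t)"
          by (intro exI[of _ "\<sigma> * D - G * (exp (\<beta> t - \<beta> T) * b t)"]) (simp add: algebra_simps)
      qed
    qed (use m(1) in auto)
    have "\<bar>x m\<bar> = G * exp (\<beta> m - \<beta> T)"
      by (simp add: G_def g_def mult.assoc exp_add[symmetric])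
    moreover have "\<bar>x m\<bar> - G * exp (\<beta> m - \<beta> T) \<le> \<bar>x T\<bar> - G"
      using step[of 1] step[of "-1"] by (simp add: abs_if split: if_splits)
    ultimately show False using hist[of T] \<open>S < G\<close> by simp
  qed
  have "\<bar>x U\<bar> \<le> G * exp (\<beta> U - \<beta> T)" using x_le \<open>T \<le> U\<close> by simp
  also have "\<dots> \<le> S * exp (\<beta> U - \<beta> T)" using \<open>G \<le> S\<close> by simp
  finally show ?thesis .
qed

section \<open>The solution concept restated over Lebesgue measure on the whole line\<close>

lemma AE_lebesgue_on_atLeast_iff:
  "(AE t in lebesgue_on {s::real..}. P t) \<longleftrightarrow> (AE t in lebesgue. s < t \<longrightarrow> P t)"
proof -
  have "(AE t in lebesgue_on {s..}. P t) \<longleftrightarrow> (AE t in lebesgue. t \<in> {s..} \<longrightarrow> P t)"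
    by (rule AE_restrict_space_iff) simp
  also have "\<dots> \<longleftrightarrow> (AE t in lebesgue. s < t \<longrightarrow> P t)"
  proof
    assume "AE t in lebesgue. t \<in> {s..} \<longrightarrow> P t"
    then show "AE t in lebesgue. s < t \<longrightarrow> P t" by eventually_elim simp
  next
    assume "AE t in lebesgue. s < t \<longrightarrow> P t"
    with AE_completion[OF AE_lborel_singleton[of s]] show "AE t in lebesgue. t \<in> {s..} \<longrightarrow> P t"
      by eventually_elim auto
  qed
  finally show ?thesis .
qed

lemma locally_abs_continuous_from_iff:
  "locally_abs_continuous_from s x \<longleftrightarrow> (\<forall>v. abs_continuous_interval x s v)"
proof
  assume x: "locally_abs_continuous_from s x"
  show "\<forall>v. abs_continuous_interval x s v"
  proof
    fix v
    have "abs_continuous_interval x s (max s v)"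
      using x by (simp add: locally_abs_continuous_from_def)
    then show "abs_continuous_interval x s v" by (rule ac_subinterval) auto
  qed
qed (simp add: locally_abs_continuous_from_def)

lemma delay_solution_iff:
  "delay_solution J a h s \<phi> x0 x \<longleftrightarrow> (\<forall>t<s. x t = \<phi> t) \<and> x s = x0 \<and>
     (\<forall>v. abs_continuous_interval x s v) \<and>
     (AE t in lebesgue. s < t \<longrightarrow> (x has_real_derivative - (\<Sum>k\<in>J. a k t * x (h k t))) (at t))"
  by (simp add: delay_solution_def AE_lebesgue_on_atLeast_iff locally_abs_continuous_from_iff)

lemma borel_measurable_extend_zero:
  fixes f :: "real \<Rightarrow> real"
  assumes "f \<in> borel_measurable (lebesgue_on {0..})"
  shows "(\<lambda>t. if t \<in> {0..} then f t else 0) \<in> borel_measurable lebesgue"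
  using assms by (subst measurable_restrict_space_iff[symmetric]) auto

text \<open>Interpreted later for the full index set and for \<open>I\<close>, the latter to obtain
  the positive solution \<open>X\<close>.\<close>

locale delay_equation =
  fixes J :: "nat set" and a h :: "nat \<Rightarrow> real \<Rightarrow> real"
  assumes finite_indices: "finite J"
    and a_measurable: "\<And>k. k \<in> J \<Longrightarrow> a k \<in> borel_measurable (lebesgue_on {0..})"
    and a_bounded: "\<And>k. k \<in> J \<Longrightarrow> ess_bounded_nonneg (a k)"
    and h_measurable: "\<And>k. k \<in> J \<Longrightarrow> h k \<in> borel_measurable (lebesgue_on {0..})"
    and h_le: "\<And>k t. k \<in> J \<Longrightarrow> 0 \<le> t \<Longrightarrow> h k t \<le> t"
begin

lemma ess_bounds:
  obtains C where "\<And>k. 0 \<le> C k" "AE t in lebesgue. 0 < t \<longrightarrow> (\<forall>k\<in>J. \<bar>a k t\<bar> \<le> C k)"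
proof -
  have "\<exists>C. AE t in lebesgue. 0 < t \<longrightarrow> \<bar>a k t\<bar> \<le> C" if "k \<in> J" for k
    using a_bounded[OF that] by (simp add: ess_bounded_nonneg_def AE_lebesgue_on_atLeast_iff)
  then obtain C where C: "\<And>k. k \<in> J \<Longrightarrow> AE t in lebesgue. 0 < t \<longrightarrow> \<bar>a k t\<bar> \<le> C k" by metis
  have "AE t in lebesgue. \<forall>k\<in>J. 0 < t \<longrightarrow> \<bar>a k t\<bar> \<le> C k"
    by (rule AE_finite_allI[OF finite_indices C])
  then have "AE t in lebesgue. 0 < t \<longrightarrow> (\<forall>k\<in>J. \<bar>a k t\<bar> \<le> \<bar>C k\<bar>)"
    by eventually_elim fastforce
  then show ?thesis by (intro that[of "\<lambda>k. \<bar>C k\<bar>"]) auto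
qed

text \<open>An instance of \<open>gronwall_retarded\<close> with linear \<open>\<beta>\<close>.
  \<open>A\<close> depends on neither the initial time nor the data: this gives uniqueness (with
  \<open>S = 0\<close>) and later bridges, uniformly, the time before the decay estimate
  starts.\<close>

lemma growth_bound:
  obtains A where "0 \<le> A"
    "\<And>s \<phi> x0 x S t. 0 \<le> s \<Longrightarrow> delay_solution J a h s \<phi> x0 x \<Longrightarrow> (\<And>t. t \<le> s \<Longrightarrow> \<bar>x t\<bar> \<le> S) \<Longrightarrow>
      s \<le> t \<Longrightarrow> \<bar>x t\<bar> \<le> S * exp (A * (t - s))"
proof -
  obtain C where C: "\<And>k. 0 \<le> C k" "AE t in lebesgue. 0 < t \<longrightarrow> (\<forall>k\<in>J. \<bar>a k t\<bar> \<le> C k)"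
    using ess_bounds by blast
  define A where "A = (\<Sum>k\<in>J. C k)"
  have "0 \<le> A" unfolding A_def by (intro sum_nonneg C)
  show ?thesis
  proof (rule that[OF \<open>0 \<le> A\<close>])
    fix s \<phi> x0 x S t
    assume s: "0 \<le> s" and x: "delay_solution J a h s \<phi> x0 x"
      and hist: "\<And>t. t \<le> s \<Longrightarrow> \<bar>x t\<bar> \<le> S" and "s \<le> t"
    have der: "AE t in lebesgue. s < t \<longrightarrow> (x has_real_derivative - (\<Sum>k\<in>J. a k t * x (h k t))) (at t)"
      using x by (simp add: delay_solution_iff)
    have "\<bar>x t\<bar> \<le> S * exp (A * t - A * s)"
    proof (rule gronwall_retarded[OF \<open>s \<le> t\<close>, where b="\<lambda>_. A"])
      show "A * u \<le> A * v" if "u \<le> v" for u v using that \<open>0 \<le> A\<close> by (rule mult_left_mono)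
      show "abs_continuous_interval (\<lambda>t. A * t) s t" by (intro ac_cmult ac_ident)
      show "AE u in lebesgue. s < u \<and> u < t \<longrightarrow> ((*) A has_real_derivative A) (at u)"
        by (auto intro!: derivative_eq_intros)
      show "abs_continuous_interval x s t" using x by (simp add: delay_solution_iff)
      show "\<bar>x u\<bar> \<le> S" if "u \<le> s" for u using that by (rule hist)
      show "AE u in lebesgue. s < u \<and> u < t \<longrightarrow> (\<exists>D. (x has_real_derivative D) (at u) \<and>
          (\<forall>G. (\<forall>r\<le>u. \<bar>x r\<bar> \<le> G) \<longrightarrow> \<bar>D\<bar> \<le> A * G))"
        using der C(2)
      proof (rule eventually_elim2, intro impI)
        fix u assume dx: "s < u \<longrightarrow> (x has_real_derivative - (\<Sum>k\<in>J. a k u * x (h k u))) (at u)"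
          and a: "0 < u \<longrightarrow> (\<forall>k\<in>J. \<bar>a k u\<bar> \<le> C k)" and u: "s < u \<and> u < t"
        have "\<bar>- (\<Sum>k\<in>J. a k u * x (h k u))\<bar> \<le> A * G" if G: "\<forall>r\<le>u. \<bar>x r\<bar> \<le> G" for G
          unfolding A_def sum_distrib_right abs_minus_cancel
        proof (rule order_trans[OF sum_abs sum_mono])
          fix k assume "k \<in> J"
          then show "\<bar>a k u * x (h k u)\<bar> \<le> C k * G"
            unfolding abs_mult using a u s h_le[of k u] G C(1)[of k] by (intro mult_mono) auto
        qed
        then show "\<exists>D. (x has_real_derivative D) (at u) \<and> (\<forall>G. (\<forall>r\<le>u. \<bar>x r\<bar> \<le> G) \<longrightarrow> \<bar>D\<bar> \<le> A * G)"
          using dx u by blast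
      qed
    qed
    then show "\<bar>x t\<bar> \<le> S * exp (A * (t - s))" by (simp add: right_diff_distrib)
  qed
qed

lemma delay_solution_unique:
  assumes "0 \<le> s" and x: "delay_solution J a h s \<phi> x0 x" and y: "delay_solution J a h s \<phi> x0 y"
  shows "x = y"
proof
  fix t
  have hist: "x t = y t" if "t \<le> s" for t
    using x y that by (cases "t = s") (auto simp: delay_solution_iff)
  have "AE t in lebesgue. s < t \<longrightarrow> (x has_real_derivative - (\<Sum>k\<in>J. a k t * x (h k t))) (at t)"
    "AE t in lebesgue. s < t \<longrightarrow> (y has_real_derivative - (\<Sum>k\<in>J. a k t * y (h k t))) (at t)"
    using x y by (simp_all add: delay_solution_iff)
  then have "AE t in lebesgue. s < t \<longrightarrow> ((\<lambda>t. x t - y t) has_real_derivative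
      - (\<Sum>k\<in>J. a k t * (x (h k t) - y (h k t)))) (at t)"
  proof (rule eventually_elim2, intro impI)
    fix t
    assume "s < t \<longrightarrow> (x has_real_derivative - (\<Sum>k\<in>J. a k t * x (h k t))) (at t)"
      and "s < t \<longrightarrow> (y has_real_derivative - (\<Sum>k\<in>J. a k t * y (h k t))) (at t)" and "s < t"
    then have "((\<lambda>t. x t - y t) has_real_derivative
        - (\<Sum>k\<in>J. a k t * x (h k t)) - - (\<Sum>k\<in>J. a k t * y (h k t))) (at t)"
      by (intro DERIV_diff) auto
    then show "((\<lambda>t. x t - y t) has_real_derivative
        - (\<Sum>k\<in>J. a k t * (x (h k t) - y (h k t)))) (at t)"
      by (simp add: right_diff_distrib sum_subtractf)
  qed
  then have sol: "delay_solution J a h s (\<lambda>_. 0) 0 (\<lambda>t. x t - y t)"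
    using x y hist by (simp add: delay_solution_iff ac_diff)
  show "x t = y t"
  proof (rule growth_bound)
    fix A :: real
    assume "\<And>s \<phi> x0 x S t. 0 \<le> s \<Longrightarrow> delay_solution J a h s \<phi> x0 x \<Longrightarrow>
      (\<And>t. t \<le> s \<Longrightarrow> \<bar>x t\<bar> \<le> S) \<Longrightarrow> s \<le> t \<Longrightarrow> \<bar>x t\<bar> \<le> S * exp (A * (t - s))"
    from this[OF \<open>0 \<le> s\<close> sol, of 0] show "x t = y t"
      using hist by (cases "s \<le> t") auto
  qed
qed

text \<open>Existence and uniqueness together make the definite description denote a
  solution.\<close>

lemma fundamental_function_solution:
  assumes "0 \<le> s"
  shows "delay_solution J a h s (\<lambda>_. 0) 1 (\<lambda>t. fundamental_function J a h t s)"
proof -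
  obtain C where C: "\<And>k. 0 \<le> C k" "AE t in lebesgue. 0 < t \<longrightarrow> (\<forall>k\<in>J. \<bar>a k t\<bar> \<le> C k)"
    using ess_bounds by blast
  \<comment> \<open>Clipping turns essential bounds into pointwise ones and, among positive times,
    alters \<open>a k\<close> only on a null set; the extension by 0 yields measurability on the
    whole line.\<close>
  define \<alpha> where "\<alpha> k t = max (- C k) (min (C k) (if t \<in> {0..} then a k t else 0))" for k t
  define \<eta> where "\<eta> k t = (if t \<in> {0..} then h k t else 0)" for k t
  obtain x where x: "\<And>t. t < s \<Longrightarrow> x t = 0" "x s = (1::real)" "\<And>v. abs_continuous_interval x s v"
    "AE t in lebesgue. t > s \<longrightarrow> (x has_real_derivative - (\<Sum>k\<in>J. \<alpha> k t * x (\<eta> k t))) (at t)"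
  proof (rule retarded_solution_exists[where K=J and \<alpha>=\<alpha> and \<eta>=\<eta> and C=C and s=s])
    fix k assume k: "k \<in> J"
    show "\<alpha> k \<in> borel_measurable lebesgue"
      unfolding \<alpha>_def by (intro borel_measurable_max borel_measurable_min borel_measurable_extend_zero a_measurable k) auto
    show "\<eta> k \<in> borel_measurable lebesgue" unfolding \<eta>_def by (intro borel_measurable_extend_zero h_measurable k)
    show "\<bar>\<alpha> k t\<bar> \<le> C k" for t using C(1)[of k] by (auto simp: \<alpha>_def)
    show "\<eta> k t \<le> t" if "s \<le> t" for t using that assms h_le[OF k, of t] by (auto simp: \<eta>_def)
  qed blast
  have "AE t in lebesgue. s < t \<longrightarrow> (x has_real_derivative - (\<Sum>k\<in>J. a k t * x (h k t))) (at t)"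
    using x(4) C(2)
  proof (rule eventually_elim2, intro impI)
    fix t assume *: "s < t \<longrightarrow> (x has_real_derivative - (\<Sum>k\<in>J. \<alpha> k t * x (\<eta> k t))) (at t)"
      "0 < t \<longrightarrow> (\<forall>k\<in>J. \<bar>a k t\<bar> \<le> C k)" "s < t"
    then have "\<alpha> k t = a k t" "\<eta> k t = h k t" if "k \<in> J" for k
      using that assms by (force simp: \<alpha>_def \<eta>_def abs_le_iff)+
    then have "(\<Sum>k\<in>J. \<alpha> k t * x (\<eta> k t)) = (\<Sum>k\<in>J. a k t * x (h k t))"
      by (intro sum.cong) auto
    then show "(x has_real_derivative - (\<Sum>k\<in>J. a k t * x (h k t))) (at t)" using * by simp
  qed
  then have sol: "delay_solution J a h s (\<lambda>_. 0) 1 x"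
    using x(1-3) by (simp add: delay_solution_iff)
  have "(THE x. delay_solution J a h s (\<lambda>_. 0) 1 x) = x"
    using sol delay_solution_unique[OF assms _ sol] by (rule the_equality)
  then show ?thesis using sol by (simp add: fundamental_function_def)
qed

end

text \<open>Links the nonnegative Lebesgue integrals in the hypotheses of the theorem with
  increments of a primitive built as a gauge integral. \<open>g\<close> is the given coefficient
  sum, \<open>f\<close> a version of it bounded everywhere.\<close>

lemma nn_integral_primitive:
  fixes f g :: "real \<Rightarrow> real"
  assumes f: "f \<in> borel_measurable lebesgue" "\<And>t. 0 \<le> f t" "\<And>t. f t \<le> C"
    and g: "AE t in lebesgue. 0 < t \<longrightarrow> g t = f t" and "0 \<le> s" "s \<le> t"
  shows "(\<integral>\<^sup>+u\<in>{s..t}. ennreal (g u) \<partial>lebesgue) = ennreal (integral {0..t} f - integral {0..s} f)"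
proof -
  have bd: "\<bar>f t\<bar> \<le> C" for t using f(2,3)[of t] by simp
  have "(\<integral>\<^sup>+u\<in>{s..t}. ennreal (g u) \<partial>lebesgue) = (\<integral>\<^sup>+u\<in>{s..t}. ennreal (f u) \<partial>lebesgue)"
  proof (rule nn_integral_cong_AE)
    show "AE u in lebesgue. ennreal (g u) * indicator {s..t} u = ennreal (f u) * indicator {s..t} u"
      using g AE_completion[OF AE_lborel_singleton[of 0]]
    proof eventually_elim
      fix u assume "0 < u \<longrightarrow> g u = f u" "u \<noteq> 0"
      then show "ennreal (g u) * indicator {s..t} u = ennreal (f u) * indicator {s..t} u"
        using \<open>0 \<le> s\<close> by (cases "u \<in> {s..t}") auto
    qed
  qed
  also have "\<dots> = ennreal (integral {s..t} f)"
    unfolding nn_integral_completion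
    using f(2) by (intro nn_integral_has_integral_lebesgue' integrable_integral
        bounded_measurable_integrable_on[OF f(1) bd]) auto
  also have "integral {s..t} f = integral {0..t} f - integral {0..s} f"
    using bounded_measurable_integral_lipschitz(1)[OF f(1) bd \<open>0 \<le> s\<close> \<open>s \<le> t\<close>] by simp
  finally show ?thesis .
qed

subsection \<open>Comparison and decay\<close>

text \<open>If \<open>m\<close> is a maximum point of \<open>y / X\<close> with value \<open>M\<close>, then \<open>M X - y\<close> is nonnegative, vanishes
  at \<open>m\<close>, and is nonincreasing to the right of \<open>m\<close>; hence \<open>y = M X \<ge> 0\<close> at the end point.\<close>

lemma supersolution_nonneg:
  fixes a h :: "nat \<Rightarrow> real \<Rightarrow> real"
  assumes "T \<le> U"
    and h: "\<And>k t. k \<in> I \<Longrightarrow> T < t \<Longrightarrow> h k t \<le> t"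
    and a: "\<And>k t. k \<in> I \<Longrightarrow> T < t \<Longrightarrow> 0 \<le> a k t"
    and acX: "abs_continuous_interval X T U"
    and X: "\<And>t. T \<le> t \<Longrightarrow> t \<le> U \<Longrightarrow> 0 < X t" "\<And>t. t < T \<Longrightarrow> 0 \<le> X t"
    and derX: "AE t in lebesgue. T < t \<and> t < U \<longrightarrow>
      (X has_real_derivative - (\<Sum>k\<in>I. a k t * X (h k t))) (at t)"
    and acy: "abs_continuous_interval y T U"
    and y: "\<And>t. t < T \<Longrightarrow> y t = 0" "0 \<le> y T"
    and dery: "AE t in lebesgue. T < t \<and> t < U \<longrightarrow>
      (\<exists>D. (y has_real_derivative D) (at t) \<and> 0 \<le> D + (\<Sum>k\<in>I. a k t * y (h k t)))"
  shows "0 \<le> y U"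
proof -
  have "continuous_on {T..U} (\<lambda>t. y t / X t)"
    using X(1) by (intro continuous_intros ac_continuous_on acX acy) (auto simp: less_imp_neq[symmetric])
  then obtain m where m: "m \<in> {T..U}" "\<And>t. t \<in> {T..U} \<Longrightarrow> y t / X t \<le> y m / X m"
    using continuous_attains_sup[of "{T..U}" "\<lambda>t. y t / X t"] \<open>T \<le> U\<close> by auto
  define M where "M = y m / X m"
  have "0 \<le> y T / X T" using y(2) X(1)[of T] \<open>T \<le> U\<close> by simp
  then have "M \<ge> 0" using m(2)[of T] \<open>T \<le> U\<close> by (simp add: M_def)
  \<comment> \<open>Delayed arguments before \<open>T\<close> are included: there \<open>y\<close>
    vanishes and \<open>M * X s\<close> is nonnegative, as \<open>0 \<le> y T\<close> forces
    \<open>0 \<le> M\<close>.\<close>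
  have le: "y s \<le> M * X s" if "s \<le> U" for s
  proof (cases "T \<le> s")
    case True
    then show ?thesis using m(2)[of s] X(1)[of s] that by (simp add: M_def pos_divide_le_eq)
  next
    case False
    then show ?thesis using y(1)[of s] X(2)[of s] \<open>M \<ge> 0\<close> by simp
  qed
  have "M * X U - y U \<le> M * X m - y m"
  proof (rule ac_nonincreasing[where f="\<lambda>t. M * X t - y t"])
    show "abs_continuous_interval (\<lambda>t. M * X t - y t) m U"
      using m(1) by (intro ac_diff ac_cmult ac_subinterval[OF acX] ac_subinterval[OF acy]) auto
    show "AE t in lebesgue. m < t \<and> t < U \<longrightarrow> (\<exists>D\<le>0. ((\<lambda>t. M * X t - y t) has_real_derivative D) (at t))"
      using derX dery
    proof (rule eventually_elim2, intro impI)
      fix t assume dX: "T < t \<and> t < U \<longrightarrow> (X has_real_derivative - (\<Sum>k\<in>I. a k t * X (h k t))) (at t)"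
        and dy: "T < t \<and> t < U \<longrightarrow>
          (\<exists>D. (y has_real_derivative D) (at t) \<and> 0 \<le> D + (\<Sum>k\<in>I. a k t * y (h k t)))"
        and "m < t \<and> t < U"
      then have t: "T < t" "t < U" using m(1) by auto
      obtain D where D: "(y has_real_derivative D) (at t)" "0 \<le> D + (\<Sum>k\<in>I. a k t * y (h k t))"
        using dy t by blast
      have "(\<Sum>k\<in>I. a k t * y (h k t)) \<le> (\<Sum>k\<in>I. a k t * (M * X (h k t)))"
        using a h le t by (intro sum_mono mult_left_mono) (meson less_imp_le order_trans)+
      also have "\<dots> = M * (\<Sum>k\<in>I. a k t * X (h k t))"
        by (simp add: sum_distrib_left mult.left_commute)
      finally have "M * - (\<Sum>k\<in>I. a k t * X (h k t)) - D \<le> 0" using D(2) by simp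
      moreover have "((\<lambda>t. M * X t - y t) has_real_derivative M * - (\<Sum>k\<in>I. a k t * X (h k t)) - D) (at t)"
        using dX t by (intro DERIV_diff DERIV_cmult D(1)) simp
      ultimately show "\<exists>D\<le>0. ((\<lambda>t. M * X t - y t) has_real_derivative D) (at t)" by blast
    qed
  qed (use m(1) in auto)
  moreover have "M * X m = y m" using X(1)[of m] m(1) by (simp add: M_def)
  moreover have "M * X U \<ge> 0" using \<open>M \<ge> 0\<close> X(1)[of U] \<open>T \<le> U\<close> by simp
  ultimately show ?thesis by simp
qed

section \<open>Perturbed solutions and their decay in the time scale \<open>B\<close>\<close>

text \<open>The asymptotic hypotheses made pointwise from \<open>T0\<close> on: \<open>L\<close>
  bounds the delays measured by \<open>B\<close>, \<open>q\<close> the ratio of coefficients,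
  written as a product so that it also covers points where the denominator vanishes.
  \<open>X\<close> must be nonnegative everywhere because delayed arguments may lie before
  \<open>T0\<close>.\<close>

locale dominated_delay_equation =
  fixes I J :: "nat set" and a h :: "nat \<Rightarrow> real \<Rightarrow> real" and B X :: "real \<Rightarrow> real" and T0 L q :: real
  assumes finite_J: "finite J" and I_subset: "I \<subseteq> J"
    and h_le: "\<And>k t. k \<in> J \<Longrightarrow> T0 \<le> t \<Longrightarrow> h k t \<le> t"
    and a_nonneg: "\<And>k t. k \<in> I \<Longrightarrow> T0 \<le> t \<Longrightarrow> 0 \<le> a k t"
    and B_ac: "\<And>s t. T0 \<le> s \<Longrightarrow> abs_continuous_interval B s t"
    and B_mono: "mono B"
    and B_deriv: "AE t in lebesgue. T0 < t \<longrightarrow> (B has_real_derivative (\<Sum>k\<in>I. a k t)) (at t)"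
    and B_unbounded: "filterlim B at_top at_top"
    and L_nonneg: "0 \<le> L"
    and delay: "\<And>k t. k \<in> J \<Longrightarrow> T0 \<le> t \<Longrightarrow> B t - B (h k t) \<le> L"
    and q: "0 \<le> q" "q < 1"
    and dominated: "\<And>t. T0 \<le> t \<Longrightarrow> (\<Sum>k\<in>J-I. \<bar>a k t\<bar>) \<le> q * (\<Sum>k\<in>I. a k t)"
    and X_nonneg: "\<And>t. 0 \<le> X t" and X_pos: "\<And>t. T0 \<le> t \<Longrightarrow> 0 < X t"
    and X_ac: "\<And>s t. T0 \<le> s \<Longrightarrow> abs_continuous_interval X s t"
    and X_deriv: "AE t in lebesgue. T0 < t \<longrightarrow>
      (X has_real_derivative - (\<Sum>k\<in>I. a k t * X (h k t))) (at t)"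
begin

abbreviation b :: "real \<Rightarrow> real" where "b t \<equiv> \<Sum>k\<in>I. a k t"

lemma b_nonneg: "T0 \<le> t \<Longrightarrow> 0 \<le> b t"
  by (intro sum_nonneg a_nonneg)

text \<open>Quantifying over all upper bounds \<open>G\<close> of the past stands for the running
  supremum of \<open>\<bar>\<xi> s\<bar>\<close>. \<open>S\<close> bounds the history and
  \<open>Q\<close> the size of the defect relative to \<open>b\<close>.\<close>

definition perturbed_solution :: "real \<Rightarrow> real \<Rightarrow> real \<Rightarrow> (real \<Rightarrow> real) \<Rightarrow> bool" where
  "perturbed_solution Q S T \<xi> \<longleftrightarrow> T0 \<le> T \<and> 0 \<le> Q \<and> (\<forall>t\<le>T. \<bar>\<xi> t\<bar> \<le> S) \<and>
     (\<forall>U. abs_continuous_interval \<xi> T U) \<and>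
     (AE t in lebesgue. T < t \<longrightarrow> (\<exists>D. (\<xi> has_real_derivative D) (at t) \<and>
        (\<forall>G. (\<forall>s\<le>t. \<bar>\<xi> s\<bar> \<le> G) \<longrightarrow> \<bar>D + (\<Sum>k\<in>I. a k t * \<xi> (h k t))\<bar> \<le> Q * b t * G)))"

lemma perturbed_solution_uminus:
  assumes "perturbed_solution Q S T \<xi>"
  shows "perturbed_solution Q S T (\<lambda>t. - \<xi> t)"
proof -
  have "(\<exists>D. ((\<lambda>t. - \<xi> t) has_real_derivative D) (at t) \<and>
        (\<forall>G. (\<forall>s\<le>t. \<bar>- \<xi> s\<bar> \<le> G) \<longrightarrow> \<bar>D + (\<Sum>k\<in>I. a k t * - \<xi> (h k t))\<bar> \<le> Q * b t * G))"
    if D: "\<exists>D. (\<xi> has_real_derivative D) (at t) \<and>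
        (\<forall>G. (\<forall>s\<le>t. \<bar>\<xi> s\<bar> \<le> G) \<longrightarrow> \<bar>D + (\<Sum>k\<in>I. a k t * \<xi> (h k t))\<bar> \<le> Q * b t * G)" for t
  proof -
    obtain D where "(\<xi> has_real_derivative D) (at t)"
      and D: "\<And>G. (\<forall>s\<le>t. \<bar>\<xi> s\<bar> \<le> G) \<Longrightarrow> \<bar>D + (\<Sum>k\<in>I. a k t * \<xi> (h k t))\<bar> \<le> Q * b t * G"
      using D by blast
    then have "((\<lambda>t. - \<xi> t) has_real_derivative - D) (at t)"
      by (intro DERIV_minus)
    moreover have "\<bar>- D + (\<Sum>k\<in>I. a k t * - \<xi> (h k t))\<bar> = \<bar>D + (\<Sum>k\<in>I. a k t * \<xi> (h k t))\<bar>"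
      by (simp add: sum_negf abs_minus_commute)
    ultimately show ?thesis
      using D by (intro exI[of _ "- D"]) simp
  qed
  then have "AE t in lebesgue. T < t \<longrightarrow> (\<exists>D. ((\<lambda>t. - \<xi> t) has_real_derivative D) (at t) \<and>
        (\<forall>G. (\<forall>s\<le>t. \<bar>- \<xi> s\<bar> \<le> G) \<longrightarrow> \<bar>D + (\<Sum>k\<in>I. a k t * - \<xi> (h k t))\<bar> \<le> Q * b t * G))"
    using assms unfolding perturbed_solution_def by (auto elim!: eventually_mono)
  then show ?thesis
    using assms unfolding perturbed_solution_def by (intro conjI allI ac_uminus) simp_all
qed

text \<open>A crude bound: the delayed terms contribute \<open>b t * G\<close> to the derivative and
  the defect \<open>Q * b t * G\<close>. It is used only over a window in which \<open>B\<close>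
  grows by at most \<open>L + 1\<close>.\<close>

lemma perturbed_solution_growth:
  assumes sol: "perturbed_solution Q S T \<xi>" and "T \<le> U"
  shows "\<bar>\<xi> U\<bar> \<le> S * exp ((1 + Q) * B U - (1 + Q) * B T)"
proof (rule gronwall_retarded[where b="\<lambda>t. (1 + Q) * b t" and x=\<xi> and \<beta>="\<lambda>t. (1 + Q) * B t"])
  have Q: "0 \<le> Q" and T: "T0 \<le> T" using sol by (auto simp: perturbed_solution_def)
  show "(1 + Q) * B s \<le> (1 + Q) * B t" if "s \<le> t" for s t
    using B_mono that Q by (intro mult_left_mono) (auto simp: mono_def)
  show "abs_continuous_interval (\<lambda>t. (1 + Q) * B t) T U"
    using T by (intro ac_cmult B_ac)
  show "AE t in lebesgue. T < t \<and> t < U \<longrightarrow> ((\<lambda>t. (1 + Q) * B t) has_real_derivative (1 + Q) * b t) (at t)"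
    using B_deriv by eventually_elim (use T in \<open>auto intro!: DERIV_cmult\<close>)
  show "abs_continuous_interval \<xi> T U"
    using sol by (simp add: perturbed_solution_def)
  show "\<bar>\<xi> t\<bar> \<le> S" if "t \<le> T" for t
    using sol that by (simp add: perturbed_solution_def)
  have "AE t in lebesgue. T < t \<longrightarrow> (\<exists>D. (\<xi> has_real_derivative D) (at t) \<and>
      (\<forall>G. (\<forall>s\<le>t. \<bar>\<xi> s\<bar> \<le> G) \<longrightarrow> \<bar>D + (\<Sum>k\<in>I. a k t * \<xi> (h k t))\<bar> \<le> Q * b t * G))"
    using sol by (simp add: perturbed_solution_def)
  then show "AE t in lebesgue. T < t \<and> t < U \<longrightarrow> (\<exists>D. (\<xi> has_real_derivative D) (at t) \<and>
      (\<forall>G. (\<forall>s\<le>t. \<bar>\<xi> s\<bar> \<le> G) \<longrightarrow> \<bar>D\<bar> \<le> (1 + Q) * b t * G))"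
  proof (rule eventually_mono, intro impI)
    fix t assume ex: "T < t \<longrightarrow> (\<exists>D. (\<xi> has_real_derivative D) (at t) \<and>
      (\<forall>G. (\<forall>s\<le>t. \<bar>\<xi> s\<bar> \<le> G) \<longrightarrow> \<bar>D + (\<Sum>k\<in>I. a k t * \<xi> (h k t))\<bar> \<le> Q * b t * G))"
      and t: "T < t \<and> t < U"
    then obtain D where D: "(\<xi> has_real_derivative D) (at t)"
      "\<And>G. (\<forall>s\<le>t. \<bar>\<xi> s\<bar> \<le> G) \<Longrightarrow> \<bar>D + (\<Sum>k\<in>I. a k t * \<xi> (h k t))\<bar> \<le> Q * b t * G" by blast
    have "\<bar>D\<bar> \<le> (1 + Q) * b t * G" if G: "\<forall>s\<le>t. \<bar>\<xi> s\<bar> \<le> G" for G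
    proof -
      have "\<bar>\<Sum>k\<in>I. a k t * \<xi> (h k t)\<bar> \<le> (\<Sum>k\<in>I. a k t * G)"
      proof (rule order_trans[OF sum_abs sum_mono])
        fix k assume "k \<in> I"
        then have "0 \<le> a k t" "h k t \<le> t" using a_nonneg h_le I_subset t T by auto
        then show "\<bar>a k t * \<xi> (h k t)\<bar> \<le> a k t * G"
          using G by (simp add: abs_mult mult_left_mono)
      qed
      moreover have "(\<Sum>k\<in>I. a k t * G) = b t * G" by (simp add: sum_distrib_right)
      moreover have "(1 + Q) * b t * G = Q * b t * G + b t * G" by (simp add: algebra_simps)
      ultimately show ?thesis using D(2)[OF G] by linarith
    qed
    then show "\<exists>D. (\<xi> has_real_derivative D) (at t) \<and>
      (\<forall>G. (\<forall>s\<le>t. \<bar>\<xi> s\<bar> \<le> G) \<longrightarrow> \<bar>D\<bar> \<le> (1 + Q) * b t * G)" using D(1) by blast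
  qed
qed (rule \<open>T \<le> U\<close>)

text \<open>Slope, per unit of \<open>S\<close>, of the growing term in the comparison function: the
  exponential part pays for the defect while \<open>\<xi>\<close> obeys the crude growth bound, the
  summand 1 for the history that is cut off.\<close>

definition history_weight :: "real \<Rightarrow> real" where
  "history_weight Q = Q * exp ((1 + Q) * (L + 1)) + 1"

text \<open>The solution is compared with \<open>N + K (B (min t V) - B T)\<close>, switched on at \<open>T\<close>. Up to the time \<open>V\<close>
  delayed arguments may still lie before \<open>T\<close>, and the growth of the second term makes up for
  them; after \<open>V\<close> the constant \<open>N\<close> alone dominates the perturbation.\<close>

lemma perturbed_solution_lower:
  assumes sol: "perturbed_solution Q S T \<xi>" and "T \<le> U"
    and M: "S \<le> M" "\<And>s. T \<le> s \<Longrightarrow> s \<le> U \<Longrightarrow> \<bar>\<xi> s\<bar> \<le> M"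
  shows "- \<xi> U \<le> Q * M + S + history_weight Q * S * (L + 1)"
proof -
  have T: "T0 \<le> T" and Q: "0 \<le> Q" and hist: "\<And>t. t \<le> T \<Longrightarrow> \<bar>\<xi> t\<bar> \<le> S"
    and ac: "\<And>U. abs_continuous_interval \<xi> T U"
    and der: "AE t in lebesgue. T < t \<longrightarrow> (\<exists>D. (\<xi> has_real_derivative D) (at t) \<and>
        (\<forall>G. (\<forall>s\<le>t. \<bar>\<xi> s\<bar> \<le> G) \<longrightarrow> \<bar>D + (\<Sum>k\<in>I. a k t * \<xi> (h k t))\<bar> \<le> Q * b t * G))"
    using sol by (auto simp: perturbed_solution_def)
  have S: "0 \<le> S" using hist[of T] by linarith
  have B_le: "B s \<le> B t" if "s \<le> t" for s t using B_mono that by (simp add: mono_def)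
  define C where "C = exp ((1 + Q) * (L + 1))"
  have "C \<ge> 1" using Q L_nonneg by (simp add: C_def)
  \<comment> \<open>In \<open>N\<close> the part \<open>Q * M\<close> balances the defect after
    \<open>V\<close>, and \<open>S\<close> makes the comparison function nonnegative at
    \<open>T\<close>. \<open>K\<close> is \<open>history_weight Q * S\<close>.\<close>
  define N K where "N = Q * M + S" and "K = (Q * C + 1) * S"
  have N: "0 \<le> N" "S \<le> N" using Q S M(1) by (auto simp: N_def)
  have K: "0 \<le> K" using Q S \<open>C \<ge> 1\<close> by (simp add: K_def)
  obtain W where W: "\<And>t. t \<ge> W \<Longrightarrow> B T + (L + 1) \<le> B t"
    using B_unbounded unfolding filterlim_at_top eventually_at_top_linorder by blast
  \<comment> \<open>After \<open>V\<close> a delayed argument satisfies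
    \<open>B (h k t) \<ge> B T + 1\<close>. The extra 1 makes this strictly larger than
    \<open>B T\<close>; since \<open>B\<close> is only monotone, equality would not exclude
    arguments before \<open>T\<close>.\<close>
  have "\<exists>V\<ge>T. V \<le> max T W \<and> B V = B T + (L + 1)"
    using L_nonneg W[of "max T W"] T by (intro IVT' ac_continuous_on B_ac) auto
  then obtain V where V: "T \<le> V" "B V = B T + (L + 1)" by blast
  have minV: "0 \<le> B (min t V) - B T" "B (min t V) - B T \<le> L + 1" if "T \<le> t" for t
    using B_le[of T "min t V"] B_le[of "min t V" V] V that by auto
  define z where "z t = N + K * (B (min t V) - B T) + \<xi> t" for t
  define y where "y t = (if t < T then 0 else z t)" for t
  have "0 \<le> y U"
  proof (rule supersolution_nonneg[OF \<open>T \<le> U\<close>, where I=I and a=a and h=h and X=X])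
    show "h k t \<le> t" "0 \<le> a k t" if "k \<in> I" "T < t" for k t
      using that T I_subset h_le a_nonneg by auto
    show "abs_continuous_interval X T U" using T by (rule X_ac)
    show "0 < X t" if "T \<le> t" for t using that T X_pos by simp
    show "AE t in lebesgue. T < t \<and> t < U \<longrightarrow>
      (X has_real_derivative - (\<Sum>k\<in>I. a k t * X (h k t))) (at t)"
      using X_deriv by eventually_elim (use T in auto)
    have "abs_continuous_interval (\<lambda>t. B (min t V)) T U"
    proof (rule ac_dominated[OF B_ac[OF T] B_ac[OF T], where M=1])
      show "\<bar>B (min t V) - B (min s V)\<bar> \<le> 1 * \<bar>B t - B s\<bar> + 1 * \<bar>B t - B s\<bar>" if "s \<le> t" for s t
        using that B_le[OF that] B_le[of V t] B_le[of s V] by (auto simp: min_def)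
    qed simp
    then have "abs_continuous_interval z T U"
      unfolding z_def by (intro ac_add ac_cmult ac_diff ac_const ac)
    then show "abs_continuous_interval y T U"
      by (rule ac_cong) (simp add: y_def)
    show "0 \<le> y T" using hist[of T] N V(1) by (simp add: y_def z_def)
    show "AE t in lebesgue. T < t \<and> t < U \<longrightarrow>
      (\<exists>D. (y has_real_derivative D) (at t) \<and> 0 \<le> D + (\<Sum>k\<in>I. a k t * y (h k t)))"
      \<comment> \<open>\<open>B (min t V)\<close> may have a corner at \<open>V\<close>, so this
        single point is removed.\<close>
      using der B_deriv AE_completion[OF AE_lborel_singleton[of V]]
    proof eventually_elim
      fix t assume dx: "T < t \<longrightarrow> (\<exists>D. (\<xi> has_real_derivative D) (at t) \<and>
        (\<forall>G. (\<forall>s\<le>t. \<bar>\<xi> s\<bar> \<le> G) \<longrightarrow> \<bar>D + (\<Sum>k\<in>I. a k t * \<xi> (h k t))\<bar> \<le> Q * b t * G))"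
        and dB: "T0 < t \<longrightarrow> (B has_real_derivative b t) (at t)" and "t \<noteq> V"
      show "T < t \<and> t < U \<longrightarrow>
        (\<exists>D. (y has_real_derivative D) (at t) \<and> 0 \<le> D + (\<Sum>k\<in>I. a k t * y (h k t)))"
      proof
        assume t: "T < t \<and> t < U"
        then obtain D where D: "(\<xi> has_real_derivative D) (at t)"
          "\<And>G. (\<forall>s\<le>t. \<bar>\<xi> s\<bar> \<le> G) \<Longrightarrow> \<bar>D + (\<Sum>k\<in>I. a k t * \<xi> (h k t))\<bar> \<le> Q * b t * G"
          using dx by blast
        have b: "0 \<le> b t" using t T by (intro b_nonneg) simp
        have a: "0 \<le> a k t" if "k \<in> I" for k using that t T a_nonneg by simp
        consider "t < V" | "V < t" using \<open>t \<noteq> V\<close> by linarith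
        then show "\<exists>D. (y has_real_derivative D) (at t) \<and> 0 \<le> D + (\<Sum>k\<in>I. a k t * y (h k t))"
        proof cases
          case 1
          have "((\<lambda>t. N + K * (B t - B T) + \<xi> t) has_real_derivative K * b t + D) (at t)"
            using dB t T by (auto intro!: derivative_eq_intros D(1))
          then have "(y has_real_derivative K * b t + D) (at t)"
            by (rule has_field_derivative_transform_within_open[where S="{T<..<V}"])
              (use t 1 in \<open>auto simp: y_def z_def\<close>)
          moreover have "\<bar>\<xi> s\<bar> \<le> C * S" if "s \<le> t" for s
          proof (cases "T \<le> s")
            case True
            have "\<bar>\<xi> s\<bar> \<le> S * exp ((1 + Q) * B s - (1 + Q) * B T)"
              by (rule perturbed_solution_growth[OF sol True])
            also have "(1 + Q) * B s - (1 + Q) * B T = (1 + Q) * (B s - B T)"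
              by (simp add: algebra_simps)
            also have "S * exp \<dots> \<le> S * C"
              unfolding C_def exp_le_cancel_iff using S Q V(2) B_le[of s V] that 1
              by (intro mult_left_mono) (auto intro!: mult_left_mono)
            finally show ?thesis by (simp add: mult.commute)
          next
            case False
            then have "\<bar>\<xi> s\<bar> \<le> 1 * S" using hist[of s] by simp
            also have "\<dots> \<le> C * S" using S \<open>C \<ge> 1\<close> by (intro mult_right_mono)
            finally show ?thesis .
          qed
          then have "\<bar>D + (\<Sum>k\<in>I. a k t * \<xi> (h k t))\<bar> \<le> Q * b t * (C * S)" using D(2) by blast
          \<comment> \<open>An argument before \<open>T\<close> has \<open>y = 0\<close> and
            \<open>\<xi> \<le> S\<close>; a later one has \<open>y \<ge> \<xi>\<close>. The loss
            \<open>b t * S\<close> is covered by the slope \<open>K\<close>.\<close>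
          moreover have "(\<Sum>k\<in>I. a k t * (\<xi> (h k t) - S)) \<le> (\<Sum>k\<in>I. a k t * y (h k t))"
          proof (intro sum_mono mult_left_mono a)
            fix k
            show "\<xi> (h k t) - S \<le> y (h k t)"
            proof (cases "h k t < T")
              case True
              then show ?thesis using hist[of "h k t"] by (simp add: y_def)
            next
              case False
              then have "0 \<le> K * (B (min (h k t) V) - B T)" using K minV by simp
              then show ?thesis using False N(1) S by (simp add: y_def z_def)
            qed
          qed
          then have "(\<Sum>k\<in>I. a k t * \<xi> (h k t)) - b t * S \<le> (\<Sum>k\<in>I. a k t * y (h k t))"
            by (simp add: right_diff_distrib sum_subtractf sum_distrib_right)
          moreover have "K * b t = Q * b t * (C * S) + b t * S"
            by (simp add: K_def algebra_simps)
          ultimately show ?thesis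
            by (intro exI[of _ "K * b t + D"]) linarith
        next
          case 2
          have "((\<lambda>t. N + K * (B V - B T) + \<xi> t) has_real_derivative D) (at t)"
            by (auto intro!: derivative_eq_intros D(1))
          then have "(y has_real_derivative D) (at t)"
            by (rule has_field_derivative_transform_within_open[where S="{V<..}"])
              (use V(1) 2 in \<open>auto simp: y_def z_def\<close>)
          moreover have "\<bar>\<xi> s\<bar> \<le> M" if "s \<le> t" for s
            using hist[of s] M(1) M(2)[of s] that t by (cases "T \<le> s") auto
          then have "\<bar>D + (\<Sum>k\<in>I. a k t * \<xi> (h k t))\<bar> \<le> Q * b t * M" using D(2) by blast
          \<comment> \<open>Every delayed argument now lies at or after \<open>T\<close>, so nothing
            is lost by the cut and \<open>b t * N\<close> alone absorbs the defect.\<close>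
          moreover have "(\<Sum>k\<in>I. a k t * (N + \<xi> (h k t))) \<le> (\<Sum>k\<in>I. a k t * y (h k t))"
          proof (intro sum_mono mult_left_mono a)
            fix k assume "k \<in> I"
            then have "B t - B (h k t) \<le> L" using delay[of k t] I_subset t T by auto
            then have "B T < B (h k t)" using V(2) B_le[of V t] 2 by simp
            then have "T \<le> h k t" using B_le[of "h k t" T] by linarith
            then have "0 \<le> K * (B (min (h k t) V) - B T)" using K minV by simp
            then show "N + \<xi> (h k t) \<le> y (h k t)" using \<open>T \<le> h k t\<close> by (simp add: y_def z_def)
          qed
          then have "(\<Sum>k\<in>I. a k t * \<xi> (h k t)) + b t * N \<le> (\<Sum>k\<in>I. a k t * y (h k t))"
            by (simp add: distrib_left sum.distrib sum_distrib_right)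
          moreover have "b t * N = Q * b t * M + b t * S"
            by (simp add: N_def algebra_simps)
          moreover have "0 \<le> b t * S" using b S by simp
          ultimately show ?thesis
            by (intro exI[of _ D]) linarith
        qed
      qed
    qed
  qed (auto simp: y_def X_nonneg)
  then have "- \<xi> U \<le> N + K * (B (min U V) - B T)"
    using \<open>T \<le> U\<close> by (simp add: y_def z_def)
  also have "\<dots> \<le> N + K * (L + 1)"
    using minV(2)[OF \<open>T \<le> U\<close>] K by (intro add_left_mono mult_left_mono)
  finally show ?thesis by (simp add: N_def K_def C_def history_weight_def)
qed

text \<open>At a maximum point \<open>m\<close> of \<open>\<bar>\<xi> t\<bar>\<close>, the one-sided
  bound for \<open>\<xi>\<close> and its negative with \<open>M = \<bar>\<xi> m\<bar>\<close>
  reproduces \<open>Q * \<bar>\<xi> m\<bar>\<close> on the right, which is absorbed since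
  \<open>Q < 1\<close>. The case \<open>\<bar>\<xi> m\<bar> \<le> S\<close> is separate because the
  one-sided bound requires \<open>S \<le> M\<close>.\<close>

lemma perturbed_solution_bounded:
  assumes sol: "perturbed_solution Q S T \<xi>" and "Q < 1" "T \<le> U"
  shows "\<bar>\<xi> U\<bar> \<le> (1 + history_weight Q * (L + 1)) / (1 - Q) * S"
proof -
  define H where "H = history_weight Q * (L + 1)"
  have Q: "0 \<le> Q" and hist: "\<And>t. t \<le> T \<Longrightarrow> \<bar>\<xi> t\<bar> \<le> S"
    and ac: "\<And>U. abs_continuous_interval \<xi> T U"
    using sol by (auto simp: perturbed_solution_def)
  have S: "0 \<le> S" using hist[of T] by linarith
  have H: "0 \<le> H" using Q L_nonneg by (simp add: H_def history_weight_def)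
  have "continuous_on {T..U} (\<lambda>t. \<bar>\<xi> t\<bar>)" by (intro continuous_intros ac_continuous_on ac)
  then obtain m where m: "m \<in> {T..U}" "\<And>t. t \<in> {T..U} \<Longrightarrow> \<bar>\<xi> t\<bar> \<le> \<bar>\<xi> m\<bar>"
    using continuous_attains_sup[of "{T..U}" "\<lambda>t. \<bar>\<xi> t\<bar>"] \<open>T \<le> U\<close> by auto
  have "(1 - Q) * \<bar>\<xi> m\<bar> \<le> (1 + H) * S"
  proof (cases "\<bar>\<xi> m\<bar> \<le> S")
    case True
    then have "(1 - Q) * \<bar>\<xi> m\<bar> \<le> 1 * S" using Q \<open>Q < 1\<close> by (intro mult_mono) auto
    also have "\<dots> \<le> (1 + H) * S" using H S by (intro mult_right_mono) auto
    finally show ?thesis .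
  next
    case False
    have "- \<xi> m \<le> Q * \<bar>\<xi> m\<bar> + S + history_weight Q * S * (L + 1)"
      using m False by (intro perturbed_solution_lower[OF sol]) auto
    moreover have "- (- \<xi> m) \<le> Q * \<bar>\<xi> m\<bar> + S + history_weight Q * S * (L + 1)"
      using m False by (intro perturbed_solution_lower[OF perturbed_solution_uminus[OF sol]]) auto
    ultimately have "\<bar>\<xi> m\<bar> \<le> Q * \<bar>\<xi> m\<bar> + S + history_weight Q * S * (L + 1)" by linarith
    then show ?thesis by (simp add: H_def algebra_simps)
  qed
  then have "\<bar>\<xi> m\<bar> \<le> (1 + H) / (1 - Q) * S"
    using \<open>Q < 1\<close> by (simp add: field_simps)
  then show ?thesis using m(2)[of U] \<open>T \<le> U\<close> unfolding H_def by auto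
qed

text \<open>For small \<open>\<nu>\<close> the function \<open>exp (\<nu> (B t - B T)) x t\<close> is a perturbed solution, so its boundedness
  yields the decay of \<open>x\<close>.\<close>

lemma solutions_decay:
  obtains \<nu> C where "0 < \<nu>" "1 \<le> C"
    "\<And>T x S t. T0 \<le> T \<Longrightarrow> (\<And>t. t \<le> T \<Longrightarrow> \<bar>x t\<bar> \<le> S) \<Longrightarrow> (\<And>U. abs_continuous_interval x T U) \<Longrightarrow>
      (AE t in lebesgue. T < t \<longrightarrow> (x has_real_derivative - (\<Sum>k\<in>J. a k t * x (h k t))) (at t)) \<Longrightarrow>
      T \<le> t \<Longrightarrow> \<bar>x t\<bar> \<le> C * S * exp (- \<nu> * (B t - B T))"
proof -
  \<comment> \<open>Three sources of defect: differentiating the weight, replacing its delayed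
    values in the terms of \<open>I\<close>, and the terms outside \<open>I\<close>. At
    \<open>\<nu> = 0\<close> only \<open>q < 1\<close> remains.\<close>
  define Q where "Q \<nu> = \<nu> + (exp (\<nu> * L) - 1) + q * exp (\<nu> * L)" for \<nu>
  have "(Q \<longlongrightarrow> Q 0) (at_right 0)"
    unfolding Q_def by (intro tendsto_intros)
  then have "eventually (\<lambda>\<nu>. Q \<nu> < 1) (at_right 0)"
    by (rule order_tendstoD(2)) (use q in \<open>simp add: Q_def\<close>)
  then have "eventually (\<lambda>\<nu>. Q \<nu> < 1 \<and> 0 < \<nu>) (at_right 0)"
    by (intro eventually_conj eventually_at_right_less)
  then obtain \<nu> where \<nu>: "Q \<nu> < 1" "0 < \<nu>"
    using eventually_happens'[OF trivial_limit_at_right_real] by blast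
  have Q0: "0 \<le> Q \<nu>" using \<nu>(2) q L_nonneg by (simp add: Q_def)
  define C where "C = (1 + history_weight (Q \<nu>) * (L + 1)) / (1 - Q \<nu>)"
  have "0 \<le> history_weight (Q \<nu>) * (L + 1)" using Q0 L_nonneg by (simp add: history_weight_def)
  then have "1 \<le> C" using \<nu>(1) Q0 by (simp add: C_def field_simps)
  show ?thesis
  proof (rule that[OF \<nu>(2) \<open>1 \<le> C\<close>])
    fix T x S t0
    assume T: "T0 \<le> T" and hist: "\<And>t. t \<le> T \<Longrightarrow> \<bar>x t\<bar> \<le> S"
      and ac: "\<And>U. abs_continuous_interval x T U"
      and der: "AE t in lebesgue. T < t \<longrightarrow> (x has_real_derivative - (\<Sum>k\<in>J. a k t * x (h k t))) (at t)"
      and "T \<le> t0"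
    have S: "0 \<le> S" using hist[of T] by linarith
    have B_le: "B s \<le> B t" if "s \<le> t" for s t using B_mono that by (simp add: mono_def)
    define \<xi> where "\<xi> t = exp (\<nu> * (B t - B T)) * x t" for t
    have "perturbed_solution (Q \<nu>) S T \<xi>"
      unfolding perturbed_solution_def
    proof (intro conjI allI impI T Q0)
      fix t assume "t \<le> T"
      then have "exp (\<nu> * (B t - B T)) \<le> 1" using \<nu>(2) B_le by (simp add: mult_nonneg_nonpos)
      then have "exp (\<nu> * (B t - B T)) * \<bar>x t\<bar> \<le> 1 * S"
        using hist[OF \<open>t \<le> T\<close>] by (intro mult_mono) auto
      then show "\<bar>\<xi> t\<bar> \<le> S" by (simp add: \<xi>_def abs_mult)
    next
      fix U
      show "abs_continuous_interval \<xi> T U"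
        unfolding \<xi>_def by (intro ac_mult ac_exp ac_cmult ac_diff ac_const ac B_ac T)
    next
      show "AE t in lebesgue. T < t \<longrightarrow> (\<exists>D. (\<xi> has_real_derivative D) (at t) \<and>
        (\<forall>G. (\<forall>s\<le>t. \<bar>\<xi> s\<bar> \<le> G) \<longrightarrow> \<bar>D + (\<Sum>k\<in>I. a k t * \<xi> (h k t))\<bar> \<le> Q \<nu> * b t * G))"
        using der B_deriv
      proof (rule eventually_elim2, intro impI)
        fix t assume dx: "T < t \<longrightarrow> (x has_real_derivative - (\<Sum>k\<in>J. a k t * x (h k t))) (at t)"
          and dB: "T0 < t \<longrightarrow> (B has_real_derivative b t) (at t)" and "T < t"
        then have t: "T0 \<le> t" using T by simp
        \<comment> \<open>The factor produced by moving the weight from \<open>t\<close> to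
          \<open>h k t\<close>; monotonicity of \<open>B\<close> and the delay bound put it between
          1 and \<open>exp (\<nu> * L)\<close>.\<close>
        define E where "E k = exp (\<nu> * (B t - B (h k t)))" for k
        have E: "1 \<le> E k" "E k \<le> exp (\<nu> * L)" if "k \<in> J" for k
          using \<nu>(2) B_le[OF h_le[OF that t]] delay[OF that t] by (auto simp: E_def)
        have ex: "exp (\<nu> * (B t - B T)) * x (h k t) = E k * \<xi> (h k t)" for k
        proof -
          have "exp (\<nu> * (B t - B T)) = E k * exp (\<nu> * (B (h k t) - B T))"
            unfolding E_def exp_add[symmetric] by (simp add: algebra_simps)
          then show ?thesis by (simp add: \<xi>_def)
        qed
        define D where "D = \<nu> * b t * \<xi> t - (\<Sum>k\<in>J. a k t * (E k * \<xi> (h k t)))"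
        have D_eq: "D = (exp (\<nu> * (B t - B T)) * (\<nu> * b t)) * x t +
            - (\<Sum>k\<in>J. a k t * x (h k t)) * exp (\<nu> * (B t - B T))"
        proof -
          have sum_eq: "(\<Sum>k\<in>J. a k t * (E k * \<xi> (h k t)))
              = (\<Sum>k\<in>J. a k t * x (h k t)) * exp (\<nu> * (B t - B T))"
            unfolding ex[symmetric] sum_distrib_right by (intro sum.cong refl) (simp add: mult_ac)
          show ?thesis unfolding D_def sum_eq unfolding \<xi>_def by (simp add: mult_ac)
        qed
        have "(\<xi> has_real_derivative D) (at t)"
          unfolding D_eq \<xi>_def using dx dB \<open>T < t\<close> T
          by (intro DERIV_mult DERIV_fun_exp DERIV_cmult) (auto intro!: derivative_eq_intros)
        moreover have "\<bar>D + (\<Sum>k\<in>I. a k t * \<xi> (h k t))\<bar> \<le> Q \<nu> * b t * G"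
          if G: "\<forall>s\<le>t. \<bar>\<xi> s\<bar> \<le> G" for G
        proof -
          have "0 \<le> G" using G[rule_format, of t] by linarith
          have Gk: "\<bar>\<xi> (h k t)\<bar> \<le> G" if "k \<in> J" for k using G h_le[OF that t] by blast
          have split: "(\<Sum>k\<in>J. a k t * (E k * \<xi> (h k t)))
              = (\<Sum>k\<in>J-I. a k t * (E k * \<xi> (h k t))) + (\<Sum>k\<in>I. a k t * (E k * \<xi> (h k t)))"
            by (rule sum.subset_diff[OF I_subset finite_J])
          have "(\<Sum>k\<in>I. a k t * (E k * \<xi> (h k t))) - (\<Sum>k\<in>I. a k t * \<xi> (h k t))
              = (\<Sum>k\<in>I. a k t * ((E k - 1) * \<xi> (h k t)))"
            by (simp add: sum_subtractf[symmetric] algebra_simps)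
          then have "D + (\<Sum>k\<in>I. a k t * \<xi> (h k t)) = \<nu> * b t * \<xi> t
              - (\<Sum>k\<in>J-I. a k t * (E k * \<xi> (h k t))) - (\<Sum>k\<in>I. a k t * ((E k - 1) * \<xi> (h k t)))"
            using split by (simp add: D_def)
          then have "\<bar>D + (\<Sum>k\<in>I. a k t * \<xi> (h k t))\<bar> \<le> \<bar>\<nu> * b t * \<xi> t\<bar>
              + \<bar>\<Sum>k\<in>J-I. a k t * (E k * \<xi> (h k t))\<bar> + \<bar>\<Sum>k\<in>I. a k t * ((E k - 1) * \<xi> (h k t))\<bar>"
            by linarith
          moreover have "\<bar>\<nu> * b t * \<xi> t\<bar> \<le> \<nu> * b t * G"
            using G \<nu>(2) b_nonneg[OF t] by (simp add: abs_mult mult_left_mono)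
          moreover have "\<bar>\<Sum>k\<in>J-I. a k t * (E k * \<xi> (h k t))\<bar> \<le> (\<Sum>k\<in>J-I. \<bar>a k t\<bar> * (exp (\<nu> * L) * G))"
          proof (rule order_trans[OF sum_abs sum_mono])
            fix k assume "k \<in> J - I"
            then have "\<bar>E k * \<xi> (h k t)\<bar> \<le> exp (\<nu> * L) * G"
              unfolding abs_mult using E[of k] Gk[of k] by (intro mult_mono) auto
            then show "\<bar>a k t * (E k * \<xi> (h k t))\<bar> \<le> \<bar>a k t\<bar> * (exp (\<nu> * L) * G)"
              unfolding abs_mult[of "a k t"] by (intro mult_left_mono) auto
          qed
          moreover have "(\<Sum>k\<in>J-I. \<bar>a k t\<bar> * (exp (\<nu> * L) * G)) \<le> q * b t * (exp (\<nu> * L) * G)"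
            unfolding sum_distrib_right[symmetric] using dominated[OF t] \<open>0 \<le> G\<close>
            by (intro mult_right_mono) auto
          moreover have "\<bar>\<Sum>k\<in>I. a k t * ((E k - 1) * \<xi> (h k t))\<bar> \<le> (\<Sum>k\<in>I. a k t * ((exp (\<nu> * L) - 1) * G))"
          proof (rule order_trans[OF sum_abs sum_mono])
            fix k assume "k \<in> I"
            then have "k \<in> J" using I_subset by auto
            then have "\<bar>(E k - 1) * \<xi> (h k t)\<bar> \<le> (exp (\<nu> * L) - 1) * G"
              unfolding abs_mult using E[of k] Gk[of k] \<nu>(2) L_nonneg by (intro mult_mono) auto
            then show "\<bar>a k t * ((E k - 1) * \<xi> (h k t))\<bar> \<le> a k t * ((exp (\<nu> * L) - 1) * G)"
              using a_nonneg[OF \<open>k \<in> I\<close> t] unfolding abs_mult[of "a k t"] by (simp add: mult_left_mono)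
          qed
          moreover have "(\<Sum>k\<in>I. a k t * ((exp (\<nu> * L) - 1) * G)) = b t * ((exp (\<nu> * L) - 1) * G)"
            by (simp add: sum_distrib_right)
          moreover have "Q \<nu> * b t * G = \<nu> * b t * G + q * b t * (exp (\<nu> * L) * G)
              + b t * ((exp (\<nu> * L) - 1) * G)"
            by (simp add: Q_def algebra_simps)
          ultimately show ?thesis by linarith
        qed
        ultimately show "\<exists>D. (\<xi> has_real_derivative D) (at t) \<and>
          (\<forall>G. (\<forall>s\<le>t. \<bar>\<xi> s\<bar> \<le> G) \<longrightarrow> \<bar>D + (\<Sum>k\<in>I. a k t * \<xi> (h k t))\<bar> \<le> Q \<nu> * b t * G)"
          by blast
      qed
    qed
    then have "\<bar>\<xi> t0\<bar> \<le> C * S"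
      using perturbed_solution_bounded \<nu>(1) \<open>T \<le> t0\<close> by (simp add: C_def)
    moreover have "\<bar>x t0\<bar> = exp (- \<nu> * (B t0 - B T)) * \<bar>\<xi> t0\<bar>"
      by (simp add: \<xi>_def abs_mult mult.assoc[symmetric] exp_add[symmetric])
    ultimately show "\<bar>x t0\<bar> \<le> C * S * exp (- \<nu> * (B t0 - B T))"
      by (simp add: mult.commute)
  qed
qed

end

section \<open>From decay in the time scale \<open>B\<close> to the three claims\<close>

text \<open>Each full step of length \<open>R\<close> between \<open>s\<close> and \<open>t\<close>
  contributes at least \<open>c\<close>; the subtracted \<open>c\<close> accounts for the incomplete
  last step.\<close>

lemma mono_linear_lower_bound:
  fixes B :: "real \<Rightarrow> real"
  assumes "mono B" "0 < R" "0 < c" and step: "\<And>t. T \<le> t \<Longrightarrow> c \<le> B (t + R) - B t"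
    and "T \<le> s" "s \<le> t"
  shows "c / R * (t - s) - c \<le> B t - B s"
proof -
  have steps: "B s + real n * c \<le> B (s + real n * R)" for n
  proof (induction n)
    case (Suc n)
    have "c \<le> B (s + real n * R + R) - B (s + real n * R)"
      using \<open>T \<le> s\<close> \<open>0 < R\<close> by (intro step) (simp add: add_increasing2)
    with Suc show ?case by (simp add: algebra_simps)
  qed simp
  define n where "n = nat \<lfloor>(t - s) / R\<rfloor>"
  have "0 \<le> (t - s) / R" using \<open>s \<le> t\<close> \<open>0 < R\<close> by simp
  then have n: "real n \<le> (t - s) / R" "(t - s) / R < real n + 1"
    unfolding n_def by linarith+
  have "s + real n * R \<le> t" using n(1) \<open>0 < R\<close> by (simp add: field_simps)
  then have "B (s + real n * R) \<le> B t" using \<open>mono B\<close> by (simp add: mono_def)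
  moreover have "((t - s) / R - 1) * c \<le> real n * c"
    using n(2) \<open>0 < c\<close> by (intro mult_right_mono) auto
  ultimately show ?thesis using steps[of n] by (simp add: algebra_simps)
qed

theorem theorem3:
  fixes m :: nat and I :: "nat set" and a h :: "nat \<Rightarrow> real \<Rightarrow> real" and E :: "real set"
  assumes a_measurable: "\<And>k. k \<in> {1..m} \<Longrightarrow> a k \<in> borel_measurable (lebesgue_on {0..})"
    and a_bounded: "\<And>k. k \<in> {1..m} \<Longrightarrow> ess_bounded_nonneg (a k)"
    and h_measurable: "\<And>k. k \<in> {1..m} \<Longrightarrow> h k \<in> borel_measurable (lebesgue_on {0..})"
    and h_le: "\<And>k t. k \<in> {1..m} \<Longrightarrow> 0 \<le> t \<Longrightarrow> h k t \<le> t"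
    and h_lim: "\<And>k. k \<in> {1..m} \<Longrightarrow> filterlim (h k) at_top at_top"
    and I_subset: "I \<subseteq> {1..m}"
    and a_nonneg: "\<And>k t. k \<in> I \<Longrightarrow> 0 \<le> t \<Longrightarrow> 0 \<le> a k t"
    and int_infinite: "(\<integral>\<^sup>+t\<in>{0..}. ennreal (\<Sum>k\<in>I. a k t) \<partial>lebesgue) = \<infinity>"
    and int_delay: "\<And>k. k \<in> {1..m} \<Longrightarrow>
      Limsup at_top (\<lambda>t. \<integral>\<^sup>+s\<in>{h k t..t}. ennreal (\<Sum>i\<in>I. a i s) \<partial>lebesgue) < \<infinity>"
    and E_eq: "E = {t. 0 \<le> t \<and> (\<Sum>k\<in>I. a k t) = 0}"
    and zero_on_E: "\<And>t. t \<in> E \<Longrightarrow> (\<Sum>k\<in>{1..m} - I. \<bar>a k t\<bar>) = 0"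
    and ratio: "Limsup (inf at_top (principal (- E)))
      (\<lambda>t. ereal ((\<Sum>k\<in>{1..m} - I. \<bar>a k t\<bar>) / (\<Sum>k\<in>I. a k t))) < 1"
    and X0_pos: "eventually_positive (fundamental_function I a h)"
  shows "all_solutions_tend_to_zero {1..m} a h \<and>
    ((\<exists>R>0. Liminf at_top (\<lambda>t. \<integral>\<^sup>+\<tau>\<in>{t..t+R}. ennreal (\<Sum>k\<in>I. a k \<tau>) \<partial>lebesgue) > 0) \<longrightarrow>
       has_exponential_estimation (fundamental_function {1..m} a h) \<and>
       ((\<forall>k\<in>{1..m}. Limsup at_top (\<lambda>t. ereal (t - h k t)) < \<infinity>) \<longrightarrow>
          exponentially_stable {1..m} a h))"
proof -
  interpret full: delay_equation "{1..m}" a h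
    by standard (simp_all add: a_measurable a_bounded h_measurable h_le)
  interpret sub: delay_equation I a h
    using I_subset a_measurable a_bounded h_measurable h_le
    by unfold_locales (auto intro: finite_subset)
  obtain C where C: "\<And>k. 0 \<le> C k" "AE t in lebesgue. 0 < t \<longrightarrow> (\<forall>k\<in>I. \<bar>a k t\<bar> \<le> C k)"
    using sub.ess_bounds by blast
  define b where "b t = (\<Sum>k\<in>I. a k t)" for t
  define A1 where "A1 = (\<Sum>k\<in>I. C k)"
  have "0 \<le> A1" unfolding A1_def by (intro sum_nonneg C)
  \<comment> \<open>A version of \<open>b\<close> bounded everywhere and equal to it at almost all
    positive times, so that its primitive \<open>B\<close> is Lipschitz on the half-line.\<close>
  define b0 where "b0 t = max 0 (min A1 (if t \<in> {0..} then b t else 0))" for t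
  have b0: "b0 \<in> borel_measurable lebesgue"
    unfolding b0_def b_def
    by (intro borel_measurable_max borel_measurable_min borel_measurable_extend_zero
        borel_measurable_sum sub.a_measurable) auto
  have b0_bd: "0 \<le> b0 t" "b0 t \<le> A1" "\<bar>b0 t\<bar> \<le> A1" for t
    using \<open>0 \<le> A1\<close> by (auto simp: b0_def)
  have b_eq: "AE t in lebesgue. 0 < t \<longrightarrow> b t = b0 t"
    using C(2)
  proof (rule eventually_mono, intro impI)
    fix t :: real assume *: "0 < t \<longrightarrow> (\<forall>k\<in>I. \<bar>a k t\<bar> \<le> C k)" "0 < t"
    then have "b t \<le> A1" unfolding b_def A1_def by (intro sum_mono) fastforce
    moreover have "0 \<le> b t" unfolding b_def using *(2) by (intro sum_nonneg a_nonneg) auto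
    ultimately show "b t = b0 t" using *(2) by (simp add: b0_def)
  qed
  define B where "B t = integral {0..t} b0" for t
  have B_nn: "(\<integral>\<^sup>+u\<in>{s..t}. ennreal (\<Sum>k\<in>I. a k u) \<partial>lebesgue) = ennreal (B t - B s)"
    if "0 \<le> s" "s \<le> t" for s t
    using nn_integral_primitive[OF b0 b0_bd(1,2) b_eq that] by (simp add: b_def B_def)
  have B_diff: "B t - B s = integral {s..t} b0" "\<bar>B t - B s\<bar> \<le> A1 * (t - s)"
    if "0 \<le> s" "s \<le> t" for s t
    using bounded_measurable_integral_lipschitz[OF b0 b0_bd(3) that] by (simp_all add: B_def)
  have int_nonneg: "0 \<le> integral {s..t} b0" for s t
    by (intro integral_nonneg bounded_measurable_integrable_on[OF b0 b0_bd(3)] b0_bd(1))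
  have "mono B"
  proof (rule monoI)
    fix s t :: real assume "s \<le> t"
    show "B s \<le> B t"
    proof (cases "0 \<le> s")
      case True
      then show ?thesis using B_diff(1)[OF True \<open>s \<le> t\<close>] int_nonneg[of s t] by simp
    next
      case False
      then show ?thesis using int_nonneg[of 0 t] by (simp add: B_def)
    qed
  qed
  have B_ac: "abs_continuous_interval B s t" if "0 \<le> s" for s t
    using that by (intro ac_lipschitz[where C=A1] B_diff(2)) auto
  have B_deriv: "AE t in lebesgue. 0 < t \<longrightarrow> (B has_real_derivative b t) (at t)"
    using lebesgue_differentiation_bounded[OF b0 b0_bd(3), of 0] b_eq
    by eventually_elim (simp add: B_def[abs_def])
  \<comment> \<open>If \<open>B\<close> stayed below \<open>Z\<close> at all naturals, monotone
    convergence would bound the integral of \<open>b\<close> by \<open>Z\<close>, against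
    \<open>int_infinite\<close>.\<close>
  have B_lim: "filterlim B at_top at_top"
    unfolding filterlim_at_top
  proof
    fix Z
    have "\<exists>n::nat. Z \<le> B (real n)"
    proof (rule ccontr)
      assume "\<nexists>n::nat. Z \<le> B (real n)"
      then have Bn: "B (real n) \<le> Z" for n by (meson linear)
      define F where "F n t = ennreal (b0 t) * indicator {0..real n} t" for n t
      have "(\<integral>\<^sup>+t\<in>{0..}. ennreal (b t) \<partial>lebesgue) = (\<integral>\<^sup>+t. (SUP n. F n t) \<partial>lebesgue)"
      proof (rule nn_integral_cong_AE)
        show "AE t in lebesgue. ennreal (b t) * indicator {0..} t = (SUP n. F n t)"
          using b_eq AE_completion[OF AE_lborel_singleton[of 0]]
        proof eventually_elim
          fix t :: real assume t: "0 < t \<longrightarrow> b t = b0 t" "t \<noteq> 0"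
          obtain n :: nat where "t \<le> real n" using real_arch_simple by blast
          then have "F n t = ennreal (b0 t) * indicator {0..} t"
            by (auto simp: F_def indicator_def)
          moreover have "F n t \<le> ennreal (b0 t) * indicator {0..} t" for n
            unfolding F_def by (intro mult_left_mono) (auto simp: indicator_def)
          ultimately have "(SUP n. F n t) = ennreal (b0 t) * indicator {0..} t"
            using SUP_upper[of n UNIV "\<lambda>n. F n t"] by (intro antisym SUP_least) auto
          then show "ennreal (b t) * indicator {0..} t = (SUP n. F n t)"
            using t by (cases "0 < t") (auto simp: indicator_def)
        qed
      qed
      also have "\<dots> = (SUP n. integral\<^sup>N lebesgue (F n))"
      proof (rule nn_integral_monotone_convergence_SUP)
        show "incseq F"
          unfolding incseq_def le_fun_def F_def
          by (intro allI impI mult_left_mono) (auto simp: indicator_def)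
        show "F n \<in> borel_measurable lebesgue" for n
          unfolding F_def
          by (intro borel_measurable_times_ennreal measurable_compose[OF b0 measurable_ennreal]
              borel_measurable_indicator) auto
      qed
      also have "\<dots> \<le> ennreal Z"
      proof (rule SUP_least)
        fix n
        have "integral\<^sup>N lebesgue (F n) = ennreal (B (real n) - B 0)"
          unfolding F_def B_def by (rule nn_integral_primitive[OF b0 b0_bd(1,2)]) auto
        also have "\<dots> \<le> ennreal Z" using Bn[of n] by (intro ennreal_leI) (simp add: B_def)
        finally show "integral\<^sup>N lebesgue (F n) \<le> ennreal Z" .
      qed
      finally show False using int_infinite by (simp add: b_def top_unique)
    qed
    then obtain n :: nat where "Z \<le> B (real n)" by blast
    then have "Z \<le> B t" if "real n \<le> t" for t
      using \<open>mono B\<close> that by (meson monoD order_trans)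
    then show "eventually (\<lambda>t. Z \<le> B t) at_top" unfolding eventually_at_top_linorder by blast
  qed
  obtain t1 where "0 \<le> t1" and t1: "\<And>s t. t1 \<le> s \<Longrightarrow> s \<le> t \<Longrightarrow> 0 < fundamental_function I a h t s"
    using X0_pos unfolding eventually_positive_def by blast
  define X where "X t = fundamental_function I a h t t1" for t
  have X_sol: "delay_solution I a h t1 (\<lambda>_. 0) 1 X"
    unfolding X_def using \<open>0 \<le> t1\<close> by (rule sub.fundamental_function_solution)
  have "\<exists>c\<ge>0. eventually (\<lambda>t. B t - B (h k t) \<le> c) at_top" if k: "k \<in> {1..m}" for k
  proof -
    obtain y where y: "Limsup at_top (\<lambda>t. \<integral>\<^sup>+s\<in>{h k t..t}. ennreal (\<Sum>i\<in>I. a i s) \<partial>lebesgue) < y" "y < \<infinity>"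
      using dense[OF int_delay[OF k]] by blast
    then obtain c where c: "y = ennreal c" "0 \<le> c" by (cases y) auto
    \<comment> \<open>The integral equals an increment of \<open>B\<close> only when
      \<open>h k t\<close> is nonnegative, which \<open>h_lim\<close> gives for large
      \<open>t\<close>.\<close>
    have "eventually (\<lambda>t. B t - B (h k t) \<le> c) at_top"
      using Limsup_lessD[OF y(1)] h_lim[OF k, unfolded filterlim_at_top, rule_format, of 0] eventually_ge_at_top[of 0]
    proof eventually_elim
      fix t assume *: "(\<integral>\<^sup>+s\<in>{h k t..t}. ennreal (\<Sum>i\<in>I. a i s) \<partial>lebesgue) < y" "0 \<le> h k t" "0 \<le> t"
      then have "ennreal (B t - B (h k t)) < ennreal c"
        using B_nn[OF *(2) h_le[OF k *(3)]] c(1) by simp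
      then show "B t - B (h k t) \<le> c"
        using ennreal_leI[of c "B t - B (h k t)"] by (cases "c \<le> B t - B (h k t)") auto
    qed
    then show ?thesis using c(2) by blast
  qed
  then obtain c where c: "\<And>k. k \<in> {1..m} \<Longrightarrow> 0 \<le> c k"
    "\<And>k. k \<in> {1..m} \<Longrightarrow> eventually (\<lambda>t. B t - B (h k t) \<le> c k) at_top"
    by metis
  \<comment> \<open>A sum in place of a maximum also covers \<open>m = 0\<close>.\<close>
  define L where "L = (\<Sum>k\<in>{1..m}. c k)"
  have "0 \<le> L" unfolding L_def by (intro sum_nonneg c(1))
  have ev_delay: "eventually (\<lambda>t. \<forall>k\<in>{1..m}. B t - B (h k t) \<le> L) at_top"
  proof (intro eventually_ball_finite ballI)
    fix k assume k: "k \<in> {1..m}"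
    have "c k \<le> L" unfolding L_def using k c(1) by (intro member_le_sum) auto
    then show "eventually (\<lambda>t. B t - B (h k t) \<le> L) at_top"
      using c(2)[OF k] by (auto elim!: eventually_mono)
  qed simp
  obtain q1 where q1: "Limsup (inf at_top (principal (- E)))
      (\<lambda>t. ereal ((\<Sum>k\<in>{1..m} - I. \<bar>a k t\<bar>) / (\<Sum>k\<in>I. a k t))) < ereal q1" "ereal q1 < 1"
    using ereal_dense2[OF ratio] by blast
  \<comment> \<open>\<open>q1\<close> was chosen merely above the limit superior, so nonnegativity
    has to be enforced.\<close>
  define q where "q = max q1 0"
  have q: "0 \<le> q" "q < 1" using q1(2) by (auto simp: q_def one_ereal_def)
  have ev_ratio: "eventually (\<lambda>t. t \<in> - E \<longrightarrow> (\<Sum>k\<in>{1..m} - I. \<bar>a k t\<bar>) / (\<Sum>k\<in>I. a k t) < q1) at_top"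
    using Limsup_lessD[OF q1(1)] by (simp add: eventually_inf_principal)
  obtain T0 where T0: "t1 \<le> T0" "\<And>t k. T0 \<le> t \<Longrightarrow> k \<in> {1..m} \<Longrightarrow> B t - B (h k t) \<le> L"
    "\<And>t. T0 \<le> t \<Longrightarrow> t \<in> - E \<Longrightarrow> (\<Sum>k\<in>{1..m} - I. \<bar>a k t\<bar>) / (\<Sum>k\<in>I. a k t) < q1"
    using eventually_conj[OF ev_delay eventually_conj[OF ev_ratio eventually_ge_at_top[of t1]]]
    unfolding eventually_at_top_linorder by (metis order_refl)
  have "0 \<le> T0" using T0(1) \<open>0 \<le> t1\<close> by simp
  interpret dom: dominated_delay_equation I "{1..m}" a h B X T0 L q
  proof
    show "finite {1..m}" "I \<subseteq> {1..m}" "mono B" "0 \<le> L" "0 \<le> q" "q < 1" "filterlim B at_top at_top"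
      by (fact I_subset \<open>mono B\<close> \<open>0 \<le> L\<close> q B_lim | simp)+
    show "h k t \<le> t" if "k \<in> {1..m}" "T0 \<le> t" for k t using that h_le \<open>0 \<le> T0\<close> by simp
    show "0 \<le> a k t" if "k \<in> I" "T0 \<le> t" for k t using that a_nonneg \<open>0 \<le> T0\<close> by simp
    show "abs_continuous_interval B s t" if "T0 \<le> s" for s t using that B_ac \<open>0 \<le> T0\<close> by simp
    show "AE t in lebesgue. T0 < t \<longrightarrow> (B has_real_derivative (\<Sum>k\<in>I. a k t)) (at t)"
      using B_deriv by eventually_elim (use \<open>0 \<le> T0\<close> in \<open>auto simp: b_def\<close>)
    show "B t - B (h k t) \<le> L" if "k \<in> {1..m}" "T0 \<le> t" for k t using that T0(2) by simp
    show "(\<Sum>k\<in>{1..m} - I. \<bar>a k t\<bar>) \<le> q * (\<Sum>k\<in>I. a k t)" if "T0 \<le> t" for t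
    proof (cases "t \<in> E")
      case True
      then show ?thesis using zero_on_E[OF True] E_eq by simp
    next
      case False
      have nonneg: "0 \<le> (\<Sum>k\<in>I. a k t)" using that \<open>0 \<le> T0\<close> by (intro sum_nonneg a_nonneg) auto
      then have pos: "0 < (\<Sum>k\<in>I. a k t)" using False that \<open>0 \<le> T0\<close> E_eq by auto
      then have "(\<Sum>k\<in>{1..m} - I. \<bar>a k t\<bar>) \<le> q1 * (\<Sum>k\<in>I. a k t)"
        using T0(3)[OF that] False by (simp add: pos_divide_less_eq)
      also have "\<dots> \<le> q * (\<Sum>k\<in>I. a k t)" using nonneg by (intro mult_right_mono) (auto simp: q_def)
      finally show ?thesis .
    qed
    show "0 < X t" if "T0 \<le> t" for t unfolding X_def using that T0(1) by (intro t1) auto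
    show "0 \<le> X t" for t
      using X_sol t1[of t1 t] by (cases "t < t1") (auto simp: delay_solution_iff X_def)
    show "abs_continuous_interval X s t" if "T0 \<le> s" for s t
    proof (rule ac_subinterval)
      show "abs_continuous_interval X t1 t" using X_sol by (simp add: delay_solution_iff)
    qed (use that T0(1) in auto)
    have "AE t in lebesgue. t1 < t \<longrightarrow> (X has_real_derivative - (\<Sum>k\<in>I. a k t * X (h k t))) (at t)"
      using X_sol by (simp add: delay_solution_iff)
    then show "AE t in lebesgue. T0 < t \<longrightarrow> (X has_real_derivative - (\<Sum>k\<in>I. a k t * X (h k t))) (at t)"
      by eventually_elim (use T0(1) in auto)
  qed
  show ?thesis
  proof (rule dom.solutions_decay)
    fix \<nu> C :: real
    assume "0 < \<nu>" "1 \<le> C"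
      and decay: "\<And>T x S t. T0 \<le> T \<Longrightarrow> (\<And>t. t \<le> T \<Longrightarrow> \<bar>x t\<bar> \<le> S) \<Longrightarrow> (\<And>U. abs_continuous_interval x T U) \<Longrightarrow>
        (AE t in lebesgue. T < t \<longrightarrow> (x has_real_derivative - (\<Sum>k\<in>{1..m}. a k t * x (h k t))) (at t)) \<Longrightarrow>
        T \<le> t \<Longrightarrow> \<bar>x t\<bar> \<le> C * S * exp (- \<nu> * (B t - B T))"
    have solution_decay: "\<bar>x t\<bar> \<le> C * S * exp (- \<nu> * (B t - B T))"
      if x: "delay_solution {1..m} a h s \<phi> x0 x" and hist: "\<And>t. t \<le> T \<Longrightarrow> \<bar>x t\<bar> \<le> S"
        and "T0 \<le> T" "s \<le> T" "T \<le> t" for s \<phi> x0 x S T t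
    proof (rule decay[OF \<open>T0 \<le> T\<close> hist _ _ \<open>T \<le> t\<close>])
      show "abs_continuous_interval x T U" for U
      proof (rule ac_subinterval)
        show "abs_continuous_interval x s U" using x by (simp add: delay_solution_iff)
      qed (use \<open>s \<le> T\<close> in auto)
      have "AE t in lebesgue. s < t \<longrightarrow> (x has_real_derivative - (\<Sum>k\<in>{1..m}. a k t * x (h k t))) (at t)"
        using x by (simp add: delay_solution_iff)
      then show "AE t in lebesgue. T < t \<longrightarrow> (x has_real_derivative - (\<Sum>k\<in>{1..m}. a k t * x (h k t))) (at t)"
        by eventually_elim (use \<open>s \<le> T\<close> in auto)
    qed
    have to_zero: "all_solutions_tend_to_zero {1..m} a h"
      unfolding all_solutions_tend_to_zero_def
    proof (intro allI impI)
      fix t0 \<phi> x0 x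
      assume "0 \<le> t0" and \<phi>: "initial_function t0 \<phi>" and x: "delay_solution {1..m} a h t0 \<phi> x0 x"
      \<comment> \<open>Decay is available only from \<open>T0\<close> on. Up to \<open>T\<close>
        the solution is bounded, by the bounded initial function before \<open>t0\<close> and by
        continuity afterwards.\<close>
      define T where "T = max T0 t0"
      obtain M1 where M1: "\<And>t. t < t0 \<Longrightarrow> \<bar>\<phi> t\<bar> \<le> M1"
        using \<phi> unfolding initial_function_def bounded_iff by auto
      obtain M2 where M2: "\<And>t. t0 \<le> t \<Longrightarrow> t \<le> T \<Longrightarrow> \<bar>x t\<bar> \<le> M2"
        using x ac_bounded[of x t0 T] unfolding delay_solution_iff by blast
      define S where "S = max M1 M2"
      have hist: "\<bar>x t\<bar> \<le> S" if "t \<le> T" for t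
      proof (cases "t < t0")
        case True
        then have "x t = \<phi> t" using x by (simp add: delay_solution_iff)
        then show ?thesis using M1[OF True] by (simp add: S_def)
      next
        case False
        then show ?thesis using M2[of t] that by (simp add: S_def)
      qed
      have "filterlim (\<lambda>t. \<nu> * (- B T + B t)) at_top at_top"
        by (intro filterlim_tendsto_pos_mult_at_top[OF tendsto_const \<open>0 < \<nu>\<close>]
            filterlim_tendsto_add_at_top[OF tendsto_const] B_lim)
      then have "filterlim (\<lambda>t. - (\<nu> * (- B T + B t))) at_bot at_top"
        by (simp add: filterlim_uminus_at_top)
      then have "((\<lambda>t. exp (- (\<nu> * (- B T + B t)))) \<longlongrightarrow> 0) at_top"
        by (rule filterlim_compose[OF exp_at_bot])
      then have lim: "((\<lambda>t. C * S * exp (- (\<nu> * (- B T + B t)))) \<longlongrightarrow> 0) at_top"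
        by (rule tendsto_mult_right_zero)
      show "(x \<longlongrightarrow> 0) at_top"
      proof (rule Lim_null_comparison[OF _ lim])
        show "eventually (\<lambda>t. norm (x t) \<le> C * S * exp (- (\<nu> * (- B T + B t)))) at_top"
          using eventually_ge_at_top[of T]
        proof eventually_elim
          fix t assume "T \<le> t"
          then have "\<bar>x t\<bar> \<le> C * S * exp (- \<nu> * (B t - B T))"
            by (intro solution_decay[OF x hist]) (auto simp: T_def)
          then show "norm (x t) \<le> C * S * exp (- (\<nu> * (- B T + B t)))" by (simp add: algebra_simps)
        qed
      qed
    qed
    show ?thesis
    proof (rule full.growth_bound)
      fix A :: real
      assume "0 \<le> A"
        and growth: "\<And>s \<phi> x0 x S t. 0 \<le> s \<Longrightarrow> delay_solution {1..m} a h s \<phi> x0 x \<Longrightarrow>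
          (\<And>t. t \<le> s \<Longrightarrow> \<bar>x t\<bar> \<le> S) \<Longrightarrow> s \<le> t \<Longrightarrow> \<bar>x t\<bar> \<le> S * exp (A * (t - s))"
      show ?thesis
      proof (intro conjI[OF to_zero] impI)
        assume "\<exists>R>0. Liminf at_top (\<lambda>t. \<integral>\<^sup>+\<tau>\<in>{t..t+R}. ennreal (\<Sum>k\<in>I. a k \<tau>) \<partial>lebesgue) > 0"
        then obtain R where "0 < R"
          and R: "0 < Liminf at_top (\<lambda>t. \<integral>\<^sup>+\<tau>\<in>{t..t+R}. ennreal (\<Sum>k\<in>I. a k \<tau>) \<partial>lebesgue)" by blast
        \<comment> \<open>The limit inferior may be infinite; an intermediate value yields a
          positive real \<open>c\<close>.\<close>
        obtain y where y: "0 < y" "y < Liminf at_top (\<lambda>t. \<integral>\<^sup>+\<tau>\<in>{t..t+R}. ennreal (\<Sum>k\<in>I. a k \<tau>) \<partial>lebesgue)"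
          using dense[OF R] by blast
        have "y < \<infinity>"
          unfolding infinity_ennreal_def by (rule order_less_le_trans[OF y(2) top_greatest])
        then obtain c where c: "y = ennreal c" "0 \<le> c" by (cases y) auto
        then have "0 < c" using y(1) by simp
        have "eventually (\<lambda>t. c \<le> B (t + R) - B t) at_top"
          using less_LiminfD[OF y(2)] eventually_ge_at_top[of 0]
        proof eventually_elim
          fix t assume "y < (\<integral>\<^sup>+\<tau>\<in>{t..t+R}. ennreal (\<Sum>k\<in>I. a k \<tau>) \<partial>lebesgue)" "0 \<le> t"
          then have "ennreal c < ennreal (B (t + R) - B t)"
            using B_nn[of t "t + R"] \<open>0 < R\<close> c(1) by simp
          then show "c \<le> B (t + R) - B t"
            using ennreal_leI[of "B (t + R) - B t" c] by (cases "c \<le> B (t + R) - B t") auto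
        qed
        then obtain T1 where T1: "\<And>t. T1 \<le> t \<Longrightarrow> c \<le> B (t + R) - B t"
          unfolding eventually_at_top_linorder by blast
        define T2 where "T2 = max T0 T1"
        have "0 \<le> T2" "T0 \<le> T2" "T1 \<le> T2" using \<open>0 \<le> T0\<close> by (auto simp: T2_def)
        \<comment> \<open>In the long run \<open>B\<close> grows by at least \<open>c / R\<close>
          per unit of time, so the rate \<open>\<nu>\<close> in \<open>B\<close> becomes
          \<open>\<nu> * c / R\<close> in \<open>t\<close>.\<close>
        define \<gamma> where "\<gamma> = \<nu> * c / R"
        have "0 < \<gamma>" using \<open>0 < \<nu>\<close> \<open>0 < c\<close> \<open>0 < R\<close> by (simp add: \<gamma>_def)
        \<comment> \<open>The factors account for growth before \<open>T2\<close>, for the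
          incomplete step in the lower bound on \<open>B\<close>, and for the start of decay at
          \<open>T \<le> s + T2\<close> in place of \<open>s\<close>.\<close>
        define K where "K = C * exp (A * T2) * exp (\<nu> * c + \<gamma> * T2)"
        have "0 < K" using \<open>1 \<le> C\<close> by (simp add: K_def)
        \<comment> \<open>Uniform in the initial time and data. It is applied with
          \<open>S = 1\<close> to the fundamental function and with \<open>\<bar>x t0\<bar>\<close>
          plus the supremum of the history to general solutions.\<close>
        have estimate: "\<bar>x t\<bar> \<le> K * exp (- \<gamma> * (t - s)) * S"
          if "0 \<le> s" and x: "delay_solution {1..m} a h s \<phi> x0 x"
            and hist: "\<And>t. t \<le> s \<Longrightarrow> \<bar>x t\<bar> \<le> S" and "s \<le> t" for s \<phi> x0 x S t
        proof -
          have "0 \<le> S" using hist[of s] by linarith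
          define T where "T = max s T2"
          define S' where "S' = S * exp (A * T2)"
          have "0 \<le> S'" using \<open>0 \<le> S\<close> by (simp add: S'_def)
          have hist': "\<bar>x r\<bar> \<le> S'" if "r \<le> T" for r
          proof (cases "r \<le> s")
            case True
            have "S * 1 \<le> S'" unfolding S'_def
              using \<open>0 \<le> S\<close> \<open>0 \<le> A\<close> \<open>0 \<le> T2\<close> by (intro mult_left_mono) auto
            then show ?thesis using hist[OF True] by simp
          next
            case False
            then have "r \<le> T2" using that by (auto simp: T_def)
            have "\<bar>x r\<bar> \<le> S * exp (A * (r - s))"
              using False by (intro growth[OF \<open>0 \<le> s\<close> x hist]) auto
            also have "\<dots> \<le> S'" unfolding S'_def
              using \<open>0 \<le> S\<close> \<open>0 \<le> A\<close> \<open>r \<le> T2\<close> \<open>0 \<le> s\<close> by (intro mult_left_mono) (auto intro: mult_left_mono)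
            finally show ?thesis .
          qed
          \<comment> \<open>For \<open>t < T\<close> the elapsed time is at most \<open>T2\<close>,
            so the exponent is nonnegative and the history bound \<open>S'\<close> suffices.\<close>
          have "\<bar>x t\<bar> \<le> C * S' * exp (\<nu> * c + \<gamma> * T2 - \<gamma> * (t - s))"
          proof (cases "T \<le> t")
            case True
            have "c / R * (t - T) - c \<le> B t - B T"
              using \<open>mono B\<close> \<open>0 < R\<close> \<open>0 < c\<close> T1 _ True
              by (rule mono_linear_lower_bound) (use \<open>T1 \<le> T2\<close> in \<open>auto simp: T_def\<close>)
            then have "\<nu> * (c / R * (t - T) - c) \<le> \<nu> * (B t - B T)"
              using \<open>0 < \<nu>\<close> by (intro mult_left_mono) auto
            moreover have "\<nu> * (c / R * (t - T) - c) = \<gamma> * (t - T) - \<nu> * c"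
              by (simp add: \<gamma>_def algebra_simps)
            moreover have "\<gamma> * (t - s - T2) \<le> \<gamma> * (t - T)"
              using \<open>0 < \<gamma>\<close> \<open>0 \<le> T2\<close> \<open>0 \<le> s\<close> by (intro mult_left_mono) (auto simp: T_def)
            moreover have "\<gamma> * (t - s - T2) = \<gamma> * (t - s) - \<gamma> * T2" by (simp add: algebra_simps)
            ultimately have "- \<nu> * (B t - B T) \<le> \<nu> * c + \<gamma> * T2 - \<gamma> * (t - s)" by simp
            then have "C * S' * exp (- \<nu> * (B t - B T)) \<le> C * S' * exp (\<nu> * c + \<gamma> * T2 - \<gamma> * (t - s))"
              using \<open>1 \<le> C\<close> \<open>0 \<le> S'\<close> by (intro mult_left_mono) auto
            moreover have "\<bar>x t\<bar> \<le> C * S' * exp (- \<nu> * (B t - B T))"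
              using True \<open>T0 \<le> T2\<close> by (intro solution_decay[OF x hist']) (auto simp: T_def)
            ultimately show ?thesis by linarith
          next
            case False
            then have "t - s \<le> T2" using \<open>s \<le> t\<close> \<open>0 \<le> s\<close> by (auto simp: T_def)
            then have "\<gamma> * (t - s) \<le> \<gamma> * T2" using \<open>0 < \<gamma>\<close> by simp
            moreover have "0 \<le> \<nu> * c" using \<open>0 < \<nu>\<close> \<open>0 < c\<close> by simp
            ultimately have "1 \<le> exp (\<nu> * c + \<gamma> * T2 - \<gamma> * (t - s))" by simp
            then have "1 * S' * 1 \<le> C * S' * exp (\<nu> * c + \<gamma> * T2 - \<gamma> * (t - s))"
              using \<open>1 \<le> C\<close> \<open>0 \<le> S'\<close> by (intro mult_mono) auto
            then show ?thesis using hist'[of t] False by simp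
          qed
          also have "exp (\<nu> * c + \<gamma> * T2 - \<gamma> * (t - s)) = exp (\<nu> * c + \<gamma> * T2) * exp (- \<gamma> * (t - s))"
            by (simp add: exp_add[symmetric])
          finally show ?thesis by (simp add: K_def S'_def mult_ac)
        qed
        have "has_exponential_estimation (fundamental_function {1..m} a h)"
          unfolding has_exponential_estimation_def
        proof (rule exI[of _ K], rule conjI[OF \<open>0 < K\<close>], rule exI[of _ \<gamma>],
            rule conjI[OF \<open>0 < \<gamma>\<close>], intro allI impI)
          fix s t :: real assume "0 \<le> s" "s \<le> t"
          have sol: "delay_solution {1..m} a h s (\<lambda>_. 0) 1 (\<lambda>t. fundamental_function {1..m} a h t s)"
            by (rule full.fundamental_function_solution[OF \<open>0 \<le> s\<close>])
          then have "\<bar>fundamental_function {1..m} a h r s\<bar> \<le> 1" if "r \<le> s" for r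
            using that by (cases "r = s") (auto simp: delay_solution_iff)
          from estimate[OF \<open>0 \<le> s\<close> sol this \<open>s \<le> t\<close>]
          show "\<bar>fundamental_function {1..m} a h t s\<bar> \<le> K * exp (- \<gamma> * (t - s))" by simp
        qed
        moreover have "exponentially_stable {1..m} a h"
          unfolding exponentially_stable_def
        proof (rule exI[of _ K], rule conjI[OF \<open>0 < K\<close>], rule exI[of _ \<gamma>],
            rule conjI[OF \<open>0 < \<gamma>\<close>], intro allI impI)
          fix t0 \<phi> x0 x t
          assume "0 \<le> t0" and \<phi>: "initial_function t0 \<phi>"
            and x: "delay_solution {1..m} a h t0 \<phi> x0 x" and "t0 \<le> t"
          have "bdd_above ((\<lambda>s. \<bar>\<phi> s\<bar>) ` {..<t0})"
            using \<phi> unfolding initial_function_def bounded_iff bdd_above_def by auto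
          then have sup: "\<bar>\<phi> r\<bar> \<le> (SUP s\<in>{..<t0}. \<bar>\<phi> s\<bar>)" if "r < t0" for r
            using that by (intro cSUP_upper) auto
          \<comment> \<open>Needed at \<open>r = t0\<close>, where \<open>\<bar>x t0\<bar>\<close>
            alone must lie below the sum; any point before \<open>t0\<close> shows it.\<close>
          have "0 \<le> (SUP s\<in>{..<t0}. \<bar>\<phi> s\<bar>)" using sup[of "t0 - 1"] by simp
          then have "\<bar>x r\<bar> \<le> \<bar>x t0\<bar> + (SUP s\<in>{..<t0}. \<bar>\<phi> s\<bar>)" if "r \<le> t0" for r
            using sup[of r] x that by (cases "r = t0") (auto simp: delay_solution_iff)
          from estimate[OF \<open>0 \<le> t0\<close> x this \<open>t0 \<le> t\<close>]
          show "\<bar>x t\<bar> \<le> K * exp (- \<gamma> * (t - t0)) * (\<bar>x t0\<bar> + (SUP s\<in>{..<t0}. \<bar>\<phi> s\<bar>))" .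
        qed
        ultimately show "has_exponential_estimation (fundamental_function {1..m} a h) \<and>
          ((\<forall>k\<in>{1..m}. Limsup at_top (\<lambda>t. ereal (t - h k t)) < \<infinity>) \<longrightarrow>
            exponentially_stable {1..m} a h)" by blast
      qed
    qed
  qed
qed

end
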